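(* There exists a universal constant $c_0>0$, and for each $\alpha\in(0,1)$ a constant $C>0$ depending only on $\alpha$, such that for all integers $m,n\ge1$ and all $\epsilon_{\max}\in[0,1]$ with $\frac{\log(2/\alpha)}{n}+\epsilon_{\max}\le c_0$, the interval $\widehat{\mathrm{CI}}=[\widehat p_{\rm left},\widehat p_{\rm right}]$ whose endpoints are the output of the algorithm described in the context (run with inputs $X_1,\dots,X_n$ and parameters $\alpha,m,\epsilon_{\max}$) satisfies $$\inf_{\epsilon\in[0,\epsilon_{\max}],\,p,\,Q}P_{\epsilon,p,Q}\big(p\in\widehat{\mathrm{CI}}\big)\ge1-\alpha,$$ $$\inf_{\epsilon\in[0,\epsilon_{\max}],\,p,\,Q}P_{\epsilon,p,Q}\big(|\widehat{\mathrm{CI}}|\le C\,\ell(n,\epsilon,m,p)\big)\ge1-\alpha.$$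
   Context: Let $n,m\ge 1$ be integers. For $\epsilon,p\in[0,1]$ and a probability distribution $Q$ on $\mathbb R$ put $P_{\epsilon,p,Q}=(1-\epsilon)\,\mathrm{Binomial}(m,p)+\epsilon Q$. The data $X_1,\dots,X_n$ are i.i.d. from $P_{\epsilon,p,Q}$, and $P_{\epsilon,p,Q}(E)$ denotes the probability of an event $E$ about $(X_1,\dots,X_n)$ under $P_{\epsilon,p,Q}^{\otimes n}$. Infima over $Q$ range over all probability distributions, over $p$ over $[0,1]$. Write $a\wedge b=\min\{a,b\}$, $a\vee b=\max\{a,b\}$, $[m]=\{1,\dots,m\}$. An interval $[L,U]$ has length $U-L$ if $U\ge L$, and is empty (of length $0$) if $U<L$. Convention: $1/\sqrt{\log(1/\epsilon)}=0$ for $\epsilon=0$. Rate: $$\ell(n,\epsilon,m,p)=\left[\left(\sqrt{\tfrac{p(1-p)}{m}}\Big(\tfrac1{\sqrt{\log n}}+\tfrac1{\sqrt{\log(1/\epsilon)}}\Big)+\tfrac1m\right)\wedge p\wedge(1-p)\right]+\tfrac1m\Big(\tfrac1n+\epsilon\Big).$$ Test quantities. For $p\in[0,1]$ and $\epsilon$, let $A=\epsilon+\sqrt{\log(24/\alpha)/(2n)}$. - $\overline t(p,\epsilon)=p-\min\Big\{\frac{p(1-p)}2,\frac18\sqrt{\frac{p(1-p)\log(1/A)}{m}}\Big\}$ for $p\in[0,1-1/m]$; $\overline t(p,\epsilon)=1-1/m$ for $p\in(1-1/m,1]$. - $\overline r(p,\epsilon)=\frac1{2m}$ for $p=0$; $\overline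 r(p,\epsilon)=\frac{p(1-p)}{4m(p-\overline t(p,\epsilon))}$ for $p\in(0,1-1/m]$; $\overline r(p,\epsilon)=(1-\frac1{6e})(1-p)$ for $p\in(1-1/m,1]$. - $\overline\tau(p,\epsilon)=\frac{11}{10}\,\mathbb P\big(\mathrm{Binomial}(m,p+\overline r(p,\epsilon))\le m\overline t(p,\epsilon)\big)$ for $p\in[0,1-1/m]$; $\overline\tau(p,\epsilon)=\frac12(1-p^m)-\frac{3\log(24/\alpha)}n$ for $p\in(1-1/m,1]$. - $\underline t(p,\epsilon)=1-\overline t(1-p,\epsilon)$, $\underline r(p,\epsilon)=\overline r(1-p,\epsilon)$, $\underline\tau(p,\epsilon)=\overline\tau(1-p,\epsilon)$. - $\phi^+_{q,\epsilon}=\mathbf 1\{\frac1n\sum_{i=1}^n\mathbf 1\{X_i\le m\overline t(q,\epsilon)\}<\overline\tau(q,\epsilon)\}$ and $\phi^-_{q,\epsilon}=\mathbf 1\{\frac1n\sum_{i=1}^n\mathbf 1\{X_i\ge m\underline t(q,\epsilon)\}<\underline\tau(q,\epsilon)\}$. Algorithm. 1. Set $p\leftarrow1$, $S_m=\{0,1/m,2/m,\dots,1\}$, $\mathcal E=\Big\{\frac{2^k\log(24/\alpha)}n:k=0,1,\dots,\big\lfloor\log_2\big(\tfrac{n\epsilon_{\max}}{\log(24/\alpha)}\big)\big\rfloor\Big\}\cup\{\epsilon_{\max}\}$ (the first set is empty if the upper limit for $k$ is negative or $\epsilon_{\max}=0$). 2. Set $$\widehat p_{\rm left}\leftarrow\Big[1-\Big(\tfrac2n\sum_{i=1}^n\mathbf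 1\{X_i\le m-1\}+\tfrac{6\log(24/\alpha)}n\Big)\wedge1\Big]^{1/m}\vee\Big(1-\tfrac1m\Big),$$ $$\widehat p_{\rm right}\leftarrow\Big(1-\Big[1-\Big(\tfrac2n\sum_{i=1}^n\mathbf 1\{X_i\ge1\}+\tfrac{6\log(24/\alpha)}n\Big)\wedge1\Big]^{1/m}\Big)\wedge\tfrac1m.$$ 3. For each $j\in[m]$ in order: set $p\leftarrow p-1/m$; if $\max_{\epsilon\in\mathcal E}\min_{q\in[0,p+1/m]\cap(S_m\setminus\{1\})}\phi^+_{q,\epsilon}=0$, set $\widehat p_{\rm left}\leftarrow p$. (After this step $p=0$.) 4. For each $j\in[m]$ in order: set $p\leftarrow p+1/m$; if $\max_{\epsilon\in\mathcal E}\min_{q\in[p-1/m,1]\cap(S_m\setminus\{0\})}\phi^-_{q,\epsilon}=0$, set $\widehat p_{\rm right}\leftarrow p$. Output $\widehat p_{\rm left},\widehat p_{\rm right}$. *)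

theory Defs
  imports "HOL-Probability.Probability"
begin

section \<open>Contaminated binomial model\<close>

definition binomial_real :: "nat \<Rightarrow> real \<Rightarrow> real measure" where
  "binomial_real m p = distr (measure_pmf (binomial_pmf m p)) borel real"

definition contaminated_binomial :: "nat \<Rightarrow> real \<Rightarrow> real \<Rightarrow> real measure \<Rightarrow> real measure" where
  "contaminated_binomial m \<epsilon> p Q = measure_of UNIV (sets borel)
     (\<lambda>A. ennreal (1 - \<epsilon>) * emeasure (binomial_real m p) A + ennreal \<epsilon> * emeasure Q A)"

lemma sets_contaminated_binomial [simp, measurable_cong]:
  "sets (contaminated_binomial m \<epsilon> p Q) = sets borel"
  unfolding contaminated_binomial_def
  by (metis sets.sets_measure_of_eq space_borel)

lemma space_contaminated_binomial [simp]: "space (contaminated_binomial m \<epsilon> p Q) = UNIV"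
  using sets_eq_imp_space_eq[OF sets_contaminated_binomial] by simp

lemma emeasure_contaminated_binomial:
  assumes "sets Q = sets borel" and A: "A \<in> sets borel"
  shows "emeasure (contaminated_binomial m \<epsilon> p Q) A =
    ennreal (1 - \<epsilon>) * emeasure (binomial_real m p) A + ennreal \<epsilon> * emeasure Q A"
proof -
  let ?\<mu> = "\<lambda>A. ennreal (1 - \<epsilon>) * emeasure (binomial_real m p) A + ennreal \<epsilon> * emeasure Q A"
  have sb: "sets (binomial_real m p) = sets borel"
    by (simp add: binomial_real_def)
  have "countably_additive (sets borel) ?\<mu>"
  proof (rule countably_additiveI)
    fix F :: "nat \<Rightarrow> real set"
    assume F: "range F \<subseteq> sets borel" "disjoint_family F"
    have "(\<Sum>i. ?\<mu> (F i)) =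
        ennreal (1 - \<epsilon>) * (\<Sum>i. emeasure (binomial_real m p) (F i)) + ennreal \<epsilon> * (\<Sum>i. emeasure Q (F i))"
      by (simp add: suminf_add[symmetric])
    also have "\<dots> = ?\<mu> (\<Union> (range F))"
      using F assms(1) sb by (simp add: suminf_emeasure)
    finally show "(\<Sum>i. ?\<mu> (F i)) = ?\<mu> (\<Union> (range F))" .
  qed
  moreover have "positive (sets borel) ?\<mu>"
    by (simp add: positive_def)
  moreover have "sigma_algebra UNIV (sets (borel :: real measure))"
    using sets.sigma_algebra_axioms[of "borel :: real measure"] by simp
  ultimately show ?thesis
    unfolding contaminated_binomial_def using A by (subst emeasure_measure_of_sigma) auto
qed

lemma real_distribution_contaminated_binomial:
  assumes "0 \<le> \<epsilon>" "\<epsilon> \<le> 1" and Q: "real_distribution Q"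
  shows "real_distribution (contaminated_binomial m \<epsilon> p Q)"
proof -
  interpret Q: real_distribution Q by fact
  interpret B: prob_space "binomial_real m p"
    unfolding binomial_real_def by (rule measure_pmf.prob_space_distr) simp
  have "emeasure (contaminated_binomial m \<epsilon> p Q) UNIV = 1"
    using assms B.emeasure_space_1 Q.emeasure_space_1
    by (subst emeasure_contaminated_binomial)
       (auto simp: binomial_real_def ennreal_plus[symmetric] simp del: ennreal_plus)
  then have "prob_space (contaminated_binomial m \<epsilon> p Q)"
    by (intro prob_spaceI) simp
  then show ?thesis
    by (simp add: real_distribution_def real_distribution_axioms_def)
qed

text \<open>Probability of an event about the sample \<open>X 1, \<dots>, X n\<close>, drawn i.i.d. from the model.\<close>

definition sample_prob ::
  "nat \<Rightarrow> nat \<Rightarrow> real \<Rightarrow> real \<Rightarrow> real measure \<Rightarrow> ((nat \<Rightarrow> real) \<Rightarrow> bool) \<Rightarrow> real" where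
  "sample_prob n m \<epsilon> p Q E =
     (let M = Pi\<^sub>M {1..n} (\<lambda>_. contaminated_binomial m \<epsilon> p Q)
      in measure M {X \<in> space M. E X})"


section \<open>Rate\<close>

definition inv_sqrt_log_inv :: "real \<Rightarrow> real" where
  "inv_sqrt_log_inv \<epsilon> = (if \<epsilon> = 0 then 0 else 1 / sqrt (ln (1 / \<epsilon>)))"

text \<open>For \<open>n = 1\<close> or \<open>\<epsilon> = 1\<close> a reciprocal of zero occurs, which HOL evaluates to 0 rather than
  infinity; these cases are excluded as soon as the bound on \<open>ln (2 / \<alpha>) / n + \<epsilon>\<^sub>m\<^sub>a\<^sub>x\<close> is below \<open>ln 2\<close>.\<close>

definition rate :: "nat \<Rightarrow> real \<Rightarrow> nat \<Rightarrow> real \<Rightarrow> real" where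
  "rate n \<epsilon> m p =
     min (min (sqrt (p * (1 - p) / real m) * (1 / sqrt (ln (real n)) + inv_sqrt_log_inv \<epsilon>) + 1 / real m)
              p) (1 - p)
     + 1 / real m * (1 / real n + \<epsilon>)"


section \<open>Tests\<close>

definition level :: "real \<Rightarrow> nat \<Rightarrow> real \<Rightarrow> real" where
  "level \<alpha> n \<epsilon> = \<epsilon> + sqrt (ln (24 / \<alpha>) / (2 * real n))"

definition t_upper :: "real \<Rightarrow> nat \<Rightarrow> nat \<Rightarrow> real \<Rightarrow> real \<Rightarrow> real" where
  "t_upper \<alpha> n m p \<epsilon> =
     (if p \<le> 1 - 1 / real m
      then p - min (p * (1 - p) / 2)
                   (1 / 8 * sqrt (p * (1 - p) * ln (1 / level \<alpha> n \<epsilon>) / real m))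
      else 1 - 1 / real m)"

definition r_upper :: "real \<Rightarrow> nat \<Rightarrow> nat \<Rightarrow> real \<Rightarrow> real \<Rightarrow> real" where
  "r_upper \<alpha> n m p \<epsilon> =
     (if p = 0 then 1 / (2 * real m)
      else if p \<le> 1 - 1 / real m then p * (1 - p) / (4 * real m * (p - t_upper \<alpha> n m p \<epsilon>))
      else (1 - 1 / (6 * exp 1)) * (1 - p))"

definition tau_upper :: "real \<Rightarrow> nat \<Rightarrow> nat \<Rightarrow> real \<Rightarrow> real \<Rightarrow> real" where
  "tau_upper \<alpha> n m p \<epsilon> =
     (if p \<le> 1 - 1 / real m
      then 11 / 10 * measure_pmf.prob (binomial_pmf m (p + r_upper \<alpha> n m p \<epsilon>))
                       {k. real k \<le> real m * t_upper \<alpha> n m p \<epsilon>}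
      else 1 / 2 * (1 - p ^ m) - 3 * ln (24 / \<alpha>) / real n)"

definition t_lower :: "real \<Rightarrow> nat \<Rightarrow> nat \<Rightarrow> real \<Rightarrow> real \<Rightarrow> real" where
  "t_lower \<alpha> n m p \<epsilon> = 1 - t_upper \<alpha> n m (1 - p) \<epsilon>"

definition r_lower :: "real \<Rightarrow> nat \<Rightarrow> nat \<Rightarrow> real \<Rightarrow> real \<Rightarrow> real" where
  "r_lower \<alpha> n m p \<epsilon> = r_upper \<alpha> n m (1 - p) \<epsilon>"

definition tau_lower :: "real \<Rightarrow> nat \<Rightarrow> nat \<Rightarrow> real \<Rightarrow> real \<Rightarrow> real" where
  "tau_lower \<alpha> n m p \<epsilon> = tau_upper \<alpha> n m (1 - p) \<epsilon>"

definition test_plus :: "real \<Rightarrow> nat \<Rightarrow> nat \<Rightarrow> (nat \<Rightarrow> real) \<Rightarrow> real \<Rightarrow> real \<Rightarrow> real" where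
  "test_plus \<alpha> n m X q \<epsilon> =
     of_bool (1 / real n * (\<Sum>i=1..n. of_bool (X i \<le> real m * t_upper \<alpha> n m q \<epsilon>)) < tau_upper \<alpha> n m q \<epsilon>)"

definition test_minus :: "real \<Rightarrow> nat \<Rightarrow> nat \<Rightarrow> (nat \<Rightarrow> real) \<Rightarrow> real \<Rightarrow> real \<Rightarrow> real" where
  "test_minus \<alpha> n m X q \<epsilon> =
     of_bool (1 / real n * (\<Sum>i=1..n. of_bool (X i \<ge> real m * t_lower \<alpha> n m q \<epsilon>)) < tau_lower \<alpha> n m q \<epsilon>)"


section \<open>Algorithm\<close>

definition p_grid :: "nat \<Rightarrow> real set" where
  "p_grid m = (\<lambda>k. real k / real m) ` {0..m}"

text \<open>The condition \<open>\<epsilon>\<^sub>m\<^sub>a\<^sub>x > 0\<close> is needed since HOL has \<open>log 2 0 = 0\<close>.\<close>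

definition eps_grid :: "real \<Rightarrow> nat \<Rightarrow> real \<Rightarrow> real set" where
  "eps_grid \<alpha> n \<epsilon>\<^sub>m\<^sub>a\<^sub>x =
     {2 ^ k * ln (24 / \<alpha>) / real n | k :: nat.
        \<epsilon>\<^sub>m\<^sub>a\<^sub>x > 0 \<and> int k \<le> \<lfloor>log 2 (real n * \<epsilon>\<^sub>m\<^sub>a\<^sub>x / ln (24 / \<alpha>))\<rfloor>} \<union> {\<epsilon>\<^sub>m\<^sub>a\<^sub>x}"

definition left_init :: "real \<Rightarrow> nat \<Rightarrow> nat \<Rightarrow> (nat \<Rightarrow> real) \<Rightarrow> real" where
  "left_init \<alpha> n m X =
     max (root m (1 - min (2 / real n * (\<Sum>i=1..n. of_bool (X i \<le> real m - 1)) + 6 * ln (24 / \<alpha>) / real n) 1))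
         (1 - 1 / real m)"

definition right_init :: "real \<Rightarrow> nat \<Rightarrow> nat \<Rightarrow> (nat \<Rightarrow> real) \<Rightarrow> real" where
  "right_init \<alpha> n m X =
     min (1 - root m (1 - min (2 / real n * (\<Sum>i=1..n. of_bool (X i \<ge> 1)) + 6 * ln (24 / \<alpha>) / real n) 1))
         (1 / real m)"

text \<open>Each loop runs over \<open>j = 1, \<dots>, m\<close>; its state is the pair of the current \<open>p\<close> and the current
  endpoint. The second loop starts from the value of \<open>p\<close> left by the first one.\<close>

definition left_step ::
  "real \<Rightarrow> nat \<Rightarrow> nat \<Rightarrow> real \<Rightarrow> (nat \<Rightarrow> real) \<Rightarrow> real \<times> real \<Rightarrow> real \<times> real" where
  "left_step \<alpha> n m \<epsilon>\<^sub>m\<^sub>a\<^sub>x X = (\<lambda>(p, left).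
     let p' = p - 1 / real m in
       (p', if (MAX \<epsilon>\<in>eps_grid \<alpha> n \<epsilon>\<^sub>m\<^sub>a\<^sub>x.
                 MIN q\<in>{0..p' + 1 / real m} \<inter> (p_grid m - {1}). test_plus \<alpha> n m X q \<epsilon>) = 0
            then p' else left))"

definition right_step ::
  "real \<Rightarrow> nat \<Rightarrow> nat \<Rightarrow> real \<Rightarrow> (nat \<Rightarrow> real) \<Rightarrow> real \<times> real \<Rightarrow> real \<times> real" where
  "right_step \<alpha> n m \<epsilon>\<^sub>m\<^sub>a\<^sub>x X = (\<lambda>(p, right).
     let p' = p + 1 / real m in
       (p', if (MAX \<epsilon>\<in>eps_grid \<alpha> n \<epsilon>\<^sub>m\<^sub>a\<^sub>x.
                 MIN q\<in>{p' - 1 / real m..1} \<inter> (p_grid m - {0}). test_minus \<alpha> n m X q \<epsilon>) = 0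
            then p' else right))"

definition ci_endpoints ::
  "real \<Rightarrow> nat \<Rightarrow> nat \<Rightarrow> real \<Rightarrow> (nat \<Rightarrow> real) \<Rightarrow> real \<times> real" where
  "ci_endpoints \<alpha> n m \<epsilon>\<^sub>m\<^sub>a\<^sub>x X =
     (let (p, left) = fold (\<lambda>_. left_step \<alpha> n m \<epsilon>\<^sub>m\<^sub>a\<^sub>x X) [1..<Suc m] (1, left_init \<alpha> n m X);
          (_, right) = fold (\<lambda>_. right_step \<alpha> n m \<epsilon>\<^sub>m\<^sub>a\<^sub>x X) [1..<Suc m] (p, right_init \<alpha> n m X)
      in (left, right))"

definition ci_left :: "real \<Rightarrow> nat \<Rightarrow> nat \<Rightarrow> real \<Rightarrow> (nat \<Rightarrow> real) \<Rightarrow> real" where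
  "ci_left \<alpha> n m \<epsilon>\<^sub>m\<^sub>a\<^sub>x X = fst (ci_endpoints \<alpha> n m \<epsilon>\<^sub>m\<^sub>a\<^sub>x X)"

definition ci_right :: "real \<Rightarrow> nat \<Rightarrow> nat \<Rightarrow> real \<Rightarrow> (nat \<Rightarrow> real) \<Rightarrow> real" where
  "ci_right \<alpha> n m \<epsilon>\<^sub>m\<^sub>a\<^sub>x X = snd (ci_endpoints \<alpha> n m \<epsilon>\<^sub>m\<^sub>a\<^sub>x X)"

definition CI :: "real \<Rightarrow> nat \<Rightarrow> nat \<Rightarrow> real \<Rightarrow> (nat \<Rightarrow> real) \<Rightarrow> real set" where
  "CI \<alpha> n m \<epsilon>\<^sub>m\<^sub>a\<^sub>x X = {ci_left \<alpha> n m \<epsilon>\<^sub>m\<^sub>a\<^sub>x X..ci_right \<alpha> n m \<epsilon>\<^sub>m\<^sub>a\<^sub>x X}"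

definition CI_length :: "real \<Rightarrow> nat \<Rightarrow> nat \<Rightarrow> real \<Rightarrow> (nat \<Rightarrow> real) \<Rightarrow> real" where
  "CI_length \<alpha> n m \<epsilon>\<^sub>m\<^sub>a\<^sub>x X =
     (let L = ci_left \<alpha> n m \<epsilon>\<^sub>m\<^sub>a\<^sub>x X; U = ci_right \<alpha> n m \<epsilon>\<^sub>m\<^sub>a\<^sub>x X in if L \<le> U then U - L else 0)"

end

theory Submission
  imports Defs
begin

text \<open>
  The interval covers \<open>p\<close> and is short because of one property of the chosen thresholds. For a grid point
  \<open>q < 1\<close>, let \<open>t\<close> and \<open>r\<close> be the threshold and the separation of the upper test and let
  \<open>F\<^sub>\<theta>\<close> denote the distribution function of \<open>Binomial(m, \<theta>)\<close> at \<open>m t\<close>. Then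
  \<open>c A powr (1 / 8) \<le> F\<^sub>q\<^sub>+\<^sub>r \<le> exp (- 1 / 4) F\<^sub>q\<close> for a universal constant \<open>c > 0\<close>, where \<open>A\<close> is the level of the
  test (\<open>threshold_bounds\<close>). The right inequality is a likelihood ratio bound. The left one is a change of
  measure to \<open>Binomial(m, q - 2 (q - t))\<close>, under which the tail has constant probability by Cantelli's
  inequality, combined with the closed form of the chi-square divergence of binomial distributions.

  The test compares the empirical tail with \<open>11 / 10 F\<^sub>q\<^sub>+\<^sub>r\<close>. If \<open>p \<le> q\<close>, then the true tail is at least
  \<open>(1 - \<epsilon>) F\<^sub>q\<close>, which is larger by a constant factor, and the test accepts (\<open>test_accepts\<close>). If
  \<open>p \<ge> q + r\<close>, then the true tail is at most \<open>F\<^sub>q\<^sub>+\<^sub>r + \<epsilon>\<close>. If in addition \<open>\<epsilon> \<le> A\<close>, then \<open>\<epsilon>\<close> is negligible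
  against \<open>A powr (1 / 8)\<close>, as \<open>A\<close> is small, and the test rejects (\<open>test_rejects\<close>). Hence the left endpoint is at
  most \<open>p\<close>, and it misses \<open>p\<close> by at most \<open>r + 1 / m\<close>, which is of the order of
  \<open>sqrt (p (1 - p) / (m ln (1 / A))) + 1 / m\<close>. At a grid level comparable to the larger of \<open>\<epsilon>\<close> and \<open>1 / n\<close>,
  the quantity \<open>1 / sqrt (ln (1 / A))\<close> is bounded by the logarithmic terms of the rate. If
  \<open>1 - p < 1 / (2 m)\<close>, then all grid points below \<open>1\<close> are rejected at such a level, and the initial endpoint, which inverts
  \<open>P(X < m) = 1 - p\<^sup>m\<close>, gives the remaining part of the rate.

  As the tails are as large as \<open>A powr (1 / 8)\<close>, empirical frequencies need only be accurate up to
  \<open>2 sqrt (level \<alpha> n 0)\<close>, that is, up to the order \<open>n powr (- 1 / 4)\<close>. Such an accuracy, uniformly over all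
  thresholds, follows from a union bound over brackets (\<open>uniform_deviation_chain\<close>), and the sharp
  Dvoretzky-Kiefer-Wolfowitz inequality is not needed. The right endpoint is one minus the left endpoint of
  the reflected sample \<open>m - X\<close> (\<open>ci_right_reflect\<close>), so all statements about samples are proved for the
  left endpoint only.
\<close>

section \<open>Lower tails of the binomial distribution\<close>

text \<open>
  The distribution function of \<open>Binomial(m, p)\<close>. The argument \<open>x\<close> is a real number because the tests
  count observations below \<open>m t\<close>, where \<open>m t\<close> need not be an integer.
\<close>

definition lower_tail :: "nat \<Rightarrow> real \<Rightarrow> real \<Rightarrow> real" where
  "lower_tail m p x = measure_pmf.prob (binomial_pmf m p) {k. real k \<le> x}"

lemma pmf_binomial_Bernstein:
  "0 \<le> p \<Longrightarrow> p \<le> 1 \<Longrightarrow> pmf (binomial_pmf m p) k = Bernstein m k p"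
  by (simp add: Bernstein_def)

lemma prob_binomial_sum:
  assumes "0 \<le> p" "p \<le> 1"
  shows "measure_pmf.prob (binomial_pmf m p) A = (\<Sum>k\<in>A \<inter> {..m}. Bernstein m k p)"
proof -
  have "measure_pmf.prob (binomial_pmf m p) A =
      measure_pmf.prob (binomial_pmf m p) (A \<inter> set_pmf (binomial_pmf m p))"
    by (simp add: measure_Int_set_pmf)
  also have "\<dots> = measure_pmf.prob (binomial_pmf m p) (A \<inter> {..m} \<inter> set_pmf (binomial_pmf m p))"
    using assms by (intro arg_cong[where f = "measure_pmf.prob _"]) (auto simp: set_pmf_binomial_eq split: if_splits)
  also have "\<dots> = measure_pmf.prob (binomial_pmf m p) (A \<inter> {..m})"
    by (simp add: measure_Int_set_pmf)
  also have "\<dots> = (\<Sum>k\<in>A \<inter> {..m}. pmf (binomial_pmf m p) k)"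
    by (simp add: measure_measure_pmf_finite)
  finally show ?thesis
    using assms by (simp add: pmf_binomial_Bernstein del: pmf_binomial)
qed

lemma lower_tail_sum:
  assumes "0 \<le> p" "p \<le> 1"
  shows "lower_tail m p x = (\<Sum>k | k \<le> m \<and> real k \<le> x. Bernstein m k p)"
proof -
  have "{k. real k \<le> x} \<inter> {..m} = {k. k \<le> m \<and> real k \<le> x}" by auto
  then show ?thesis using prob_binomial_sum[OF assms] by (simp add: lower_tail_def)
qed

lemma lower_tail_nonneg: "0 \<le> lower_tail m p x"
  by (simp add: lower_tail_def)

lemma lower_tail_mono: "x \<le> y \<Longrightarrow> lower_tail m p x \<le> lower_tail m p y"
  unfolding lower_tail_def by (intro measure_pmf.finite_measure_mono) auto

lemma lower_tail_Suc:
  assumes "0 \<le> p" "p \<le> 1"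
  shows "lower_tail (Suc m) p x = p * lower_tail m p (x - 1) + (1 - p) * lower_tail m p x"
proof -
  have p: "p \<in> {0..1}" using assms by simp
  have bind: "measure_pmf.prob (binomial_pmf m p \<bind> (\<lambda>k. return_pmf (c + k))) {k. real k \<le> x} =
      measure_pmf.prob (binomial_pmf m p) {k. real (c + k) \<le> x}" for c
    by (subst map_pmf_def[symmetric]) (simp add: vimage_def)
  have "measure_pmf.prob (binomial_pmf (Suc m) p) {k. real k \<le> x} =
     measure_pmf.expectation (bernoulli_pmf p) (\<lambda>b. measure_pmf.prob (binomial_pmf m p \<bind> (\<lambda>k. return_pmf ((if b then 1 else 0) + k))) {k. real k \<le> x})"
    unfolding binomial_pmf_Suc[OF p] measure_pmf_bind
    by (subst measure_pmf.measure_bind[where N = "count_space UNIV"])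
       (auto simp: measure_pmf_in_subprob_algebra simp flip: measure_pmf_bind)
  also have "\<dots> = p * lower_tail m p (x - 1) + (1 - p) * lower_tail m p x"
    using assms unfolding bind
    by (subst integral_bernoulli_pmf) (auto simp: lower_tail_def algebra_simps)
  finally show ?thesis by (simp add: lower_tail_def)
qed

text \<open>
  Stochastic monotonicity in \<open>p\<close>, by induction on \<open>m\<close>: conditioning on one Bernoulli trial averages
  the tail at \<open>x - 1\<close> and the larger tail at \<open>x\<close>, and the weight of the smaller one grows with the
  success probability.
\<close>

lemma lower_tail_antimono:
  assumes "0 \<le> p" "p \<le> q" "q \<le> 1"
  shows "lower_tail m q x \<le> lower_tail m p x"
proof (induction m arbitrary: x)
  case 0
  then show ?case using assms by (simp add: lower_tail_def binomial_pmf_0)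
next
  case (Suc m)
  have "lower_tail (Suc m) q x = q * lower_tail m q (x - 1) + (1 - q) * lower_tail m q x"
    using assms by (intro lower_tail_Suc) auto
  also have "\<dots> \<le> q * lower_tail m p (x - 1) + (1 - q) * lower_tail m p x"
    using assms Suc.IH by (intro add_mono mult_left_mono) auto
  also have "\<dots> = lower_tail m p x - q * (lower_tail m p x - lower_tail m p (x - 1))"
    by (simp add: algebra_simps)
  also have "\<dots> \<le> lower_tail m p x - p * (lower_tail m p x - lower_tail m p (x - 1))"
    using assms lower_tail_mono[of "x - 1" x m p]
    by (intro diff_left_mono mult_right_mono) auto
  also have "\<dots> = lower_tail (Suc m) p x"
    using assms by (subst lower_tail_Suc) (auto simp: algebra_simps)
  finally show ?case .
qed

lemma lower_tail_below:
  assumes "0 \<le> p" "p \<le> 1" "1 \<le> m"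
  shows "lower_tail m p (real m - 1) = 1 - p ^ m"
proof -
  have eq: "{k. k \<le> m \<and> real k \<le> real m - 1} = {..m} - {m}" using assms(3) by auto
  have "lower_tail m p (real m - 1) = (\<Sum>k\<in>{..m} - {m}. Bernstein m k p)"
    using assms lower_tail_sum eq by simp
  also have "\<dots> = 1 - Bernstein m m p"
    by (subst sum_diff) auto
  finally show ?thesis by (simp add: Bernstein_def)
qed

lemma lower_tail_zero:
  assumes "0 \<le> p" "p \<le> 1"
  shows "lower_tail m p 0 = (1 - p) ^ m"
proof -
  have "{k. k \<le> m \<and> real k \<le> 0} = {0}" by auto
  then show ?thesis using assms lower_tail_sum by (simp add: Bernstein_def)
qed

lemma Bernstein_reflect:
  assumes "k \<le> m"
  shows "Bernstein m (m - k) (1 - p) = Bernstein m k p"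
  using assms by (simp add: Bernstein_def binomial_symmetric[of k m])

lemma lower_tail_reflect:
  assumes "0 \<le> p" "p \<le> 1"
  shows "lower_tail m (1 - p) x = measure_pmf.prob (binomial_pmf m p) {k. real m - x \<le> real k}"
proof -
  have "lower_tail m (1 - p) x = (\<Sum>k | k \<le> m \<and> real k \<le> x. Bernstein m k (1 - p))"
    using assms by (intro lower_tail_sum) auto
  also have "\<dots> = (\<Sum>k\<in>{k. real m - x \<le> real k} \<inter> {..m}. Bernstein m k p)"
    by (rule sum.reindex_bij_witness[of _ "\<lambda>k. m - k" "\<lambda>k. m - k"])
       (use Bernstein_reflect[of _ m "1 - p"] in \<open>auto simp: of_nat_diff\<close>)
  finally show ?thesis using prob_binomial_sum[OF assms] by simp
qed

text \<open>
  For \<open>k \<le> m t\<close> the likelihood ratio of \<open>q + r\<close> against \<open>q\<close> at \<open>k\<close> is at most its value at \<open>m t\<close>, and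
  \<open>1 + x \<le> exp x\<close> bounds the latter. The value of \<open>r\<close> used by the tests makes the exponent \<open>- 1 / 4\<close>.
\<close>

lemma lower_tail_tilt_le:
  assumes q: "0 < q" "q < 1" and r: "0 \<le> r" "r < 1 - q"
  shows "lower_tail m (q + r) (real m * t) \<le>
     exp (- (real m * r * (q - t) / (q * (1 - q)))) * lower_tail m q (real m * t)"
proof -
  have "Bernstein m k (q + r) \<le> exp (- (real m * r * (q - t) / (q * (1 - q)))) * Bernstein m k q"
    if k: "k \<le> m" "real k \<le> real m * t" for k
  proof -
    have e1: "q + r \<le> q * exp (r / q)"
    proof -
      have "q * (1 + r / q) \<le> q * exp (r / q)"
        using q by (intro mult_left_mono exp_ge_add_one_self) auto
      then show ?thesis using q by (simp add: distrib_left)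
    qed
    have e2: "1 - (q + r) \<le> (1 - q) * exp (- r / (1 - q))"
    proof -
      have "(1 - q) * (1 + (- r / (1 - q))) \<le> (1 - q) * exp (- r / (1 - q))"
        using q by (intro mult_left_mono exp_ge_add_one_self) auto
      moreover have "(1 - q) * (1 + (- r / (1 - q))) = 1 - (q + r)"
        using q by (simp add: field_simps)
      ultimately show ?thesis by simp
    qed
    have "(q + r) ^ k * (1 - (q + r)) ^ (m - k) \<le>
       (q * exp (r / q)) ^ k * ((1 - q) * exp (- r / (1 - q))) ^ (m - k)"
      using q r e1 e2 by (intro mult_mono power_mono) auto
    also have "\<dots> = q ^ k * (1 - q) ^ (m - k) *
        exp (real k * (r / q) + real (m - k) * (- r / (1 - q)))"
      unfolding exp_add exp_of_nat_mult by (simp add: power_mult_distrib)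
    also have "\<dots> \<le> q ^ k * (1 - q) ^ (m - k) * exp (- (real m * r * (q - t) / (q * (1 - q))))"
    proof -
      have "real k * (r / q) + real (m - k) * (- r / (1 - q)) = r * (real k - m * q) / (q * (1 - q))"
      proof -
        have "real k * (r / q) + (real m - real k) * (- r / (1 - q)) = r * (real k - m * q) / (q * (1 - q))"
          using q by (simp add: divide_simps) (simp add: algebra_simps)
        then show ?thesis using k by (simp add: of_nat_diff)
      qed
      also have "\<dots> \<le> r * (m * t - m * q) / (q * (1 - q))"
        using q r k by (intro divide_right_mono mult_left_mono) auto
      also have "\<dots> = - (real m * r * (q - t) / (q * (1 - q)))"
        by (subst minus_divide_left) (simp add: algebra_simps)
      finally show ?thesis using q by (intro mult_left_mono) auto
    qed
    finally have "real (m choose k) * ((q + r) ^ k * (1 - (q + r)) ^ (m - k)) \<le>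
        real (m choose k) * (q ^ k * (1 - q) ^ (m - k) * exp (- (real m * r * (q - t) / (q * (1 - q)))))"
      by (intro mult_left_mono) auto
    then show ?thesis
      unfolding Bernstein_def by (simp only: mult_ac)
  qed
  moreover have "lower_tail m (q + r) (real m * t) = (\<Sum>k | k \<le> m \<and> real k \<le> real m * t. Bernstein m k (q + r))"
    using q r by (intro lower_tail_sum) auto
  moreover have "lower_tail m q (real m * t) = (\<Sum>k | k \<le> m \<and> real k \<le> real m * t. Bernstein m k q)"
    using q by (intro lower_tail_sum) auto
  ultimately show ?thesis
    by (auto simp only: sum_distrib_left intro!: sum_mono)
qed

text \<open>
  A lower bound for the tail at \<open>\<theta>\<close> in terms of the tail at another parameter \<open>s\<close>: by the Cauchy-Schwarz
  inequality, \<open>R(E)\<^sup>2 \<le> P(E) (1 + \<chi>\<^sup>2(R, P))\<close>, and for two binomial distributions the last factor equals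
  \<open>(1 + (\<theta> - s)\<^sup>2 / (\<theta> (1 - \<theta>)))\<^sup>m\<close> by the binomial theorem.
\<close>

lemma lower_tail_chi_square:
  assumes s: "0 \<le> s" "s \<le> 1" and \<theta>: "0 < \<theta>" "\<theta> < 1"
  shows "(lower_tail m s x)\<^sup>2 \<le> lower_tail m \<theta> x * exp (real m * (\<theta> - s)\<^sup>2 / (\<theta> * (1 - \<theta>)))"
proof -
  let ?K = "{k. k \<le> m \<and> real k \<le> x}"
  have pos: "0 < Bernstein m k \<theta>" if "k \<le> m" for k
    using that \<theta> by (simp add: Bernstein_pos)
  have nn: "0 \<le> Bernstein m k s" for k using s by (simp add: Bernstein_nonneg)
  have sq: "(Bernstein m k s)\<^sup>2 / Bernstein m k \<theta> = real (m choose k) * (s\<^sup>2 / \<theta>) ^ k * ((1 - s)\<^sup>2 / (1 - \<theta>)) ^ (m - k)"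
    if "k \<le> m" for k
    using that \<theta> unfolding Bernstein_def
    by (simp add: power_divide power_mult_distrib power2_eq_square)
  have "(lower_tail m s x)\<^sup>2 = (\<Sum>k\<in>?K. sqrt (Bernstein m k \<theta>) * (Bernstein m k s / sqrt (Bernstein m k \<theta>)))\<^sup>2"
    unfolding lower_tail_sum[OF s] by (intro arg_cong[where f = "\<lambda>u. u\<^sup>2"] sum.cong refl) (use pos in \<open>force simp: less_imp_neq\<close>)
  also have "\<dots> \<le> (\<Sum>k\<in>?K. (sqrt (Bernstein m k \<theta>))\<^sup>2) * (\<Sum>k\<in>?K. (Bernstein m k s / sqrt (Bernstein m k \<theta>))\<^sup>2)"
    by (rule Cauchy_Schwarz_ineq_sum)
  also have "\<dots> = lower_tail m \<theta> x * (\<Sum>k\<in>?K. (Bernstein m k s)\<^sup>2 / Bernstein m k \<theta>)"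
    using \<theta> pos by (simp add: lower_tail_sum power_divide less_imp_le)
  also have "\<dots> \<le> lower_tail m \<theta> x * (\<Sum>k\<le>m. (Bernstein m k s)\<^sup>2 / Bernstein m k \<theta>)"
    by (intro mult_left_mono sum_mono2 lower_tail_nonneg) (auto intro!: divide_nonneg_pos pos)
  also have "(\<Sum>k\<le>m. (Bernstein m k s)\<^sup>2 / Bernstein m k \<theta>) = (s\<^sup>2 / \<theta> + (1 - s)\<^sup>2 / (1 - \<theta>)) ^ m"
    by (simp add: binomial_ring sq)
  also have "s\<^sup>2 / \<theta> + (1 - s)\<^sup>2 / (1 - \<theta>) = 1 + (\<theta> - s)\<^sup>2 / (\<theta> * (1 - \<theta>))"
    using \<theta> by (simp add: field_simps power2_eq_square)
  also have "(1 + (\<theta> - s)\<^sup>2 / (\<theta> * (1 - \<theta>))) ^ m \<le> exp ((\<theta> - s)\<^sup>2 / (\<theta> * (1 - \<theta>))) ^ m"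
    using \<theta> by (intro power_mono exp_ge_add_one_self add_nonneg_nonneg) auto
  also have "\<dots> = exp (real m * (\<theta> - s)\<^sup>2 / (\<theta> * (1 - \<theta>)))"
    by (simp flip: exp_of_nat_mult)
  finally show ?thesis
    using lower_tail_nonneg by (simp add: mult_left_mono)
qed

text \<open>
  Cantelli's inequality, with the denominator multiplied out: the tail at distance \<open>m d\<close> above the mean
  is at least \<open>(m d)\<^sup>2 / (m s (1 - s) + (m d)\<^sup>2)\<close>.
\<close>

lemma lower_tail_Cantelli:
  assumes s: "0 \<le> s" "s \<le> 1" and d: "0 \<le> d"
  shows "(real m * d)\<^sup>2 \<le> lower_tail m s (real m * (s + d)) * (real m * s * (1 - s) + (real m * d)\<^sup>2)"
proof -
  define a where "a = real m * (s + d)"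
  let ?K = "{k. k \<le> m \<and> real k \<le> a}"
  let ?b = "\<lambda>k. Bernstein m k s"
  have nn: "0 \<le> ?b k" for k using s by (simp add: Bernstein_nonneg)
  have first: "(\<Sum>k\<le>m. (a - real k) * ?b k) = real m * d"
    by (simp add: left_diff_distrib sum_subtractf flip: sum_distrib_left) (simp add: a_def algebra_simps)
  have "(\<Sum>k\<le>m. (a - real k)\<^sup>2 * ?b k) = (\<Sum>k\<le>m. real k * (real k - 1) * ?b k + (1 - 2 * a) * (real k * ?b k) + a\<^sup>2 * ?b k)"
    by (intro sum.cong refl) (simp add: power2_eq_square algebra_simps)
  also have "\<dots> = real m * (real m - 1) * s\<^sup>2 + (1 - 2 * a) * (real m * s) + a\<^sup>2"
    by (simp add: sum.distrib flip: sum_distrib_left)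
  also have "\<dots> = real m * s * (1 - s) + (real m * d)\<^sup>2"
    by (simp add: a_def power2_eq_square algebra_simps)
  finally have second: "(\<Sum>k\<le>m. (a - real k)\<^sup>2 * ?b k) = real m * s * (1 - s) + (real m * d)\<^sup>2" .
  have "real m * d = (\<Sum>k\<le>m. (a - real k) * ?b k)" using first by simp
  also have "\<dots> \<le> (\<Sum>k\<in>?K. (a - real k) * ?b k)"
  proof -
    have "(\<Sum>k\<le>m. (a - real k) * ?b k) = (\<Sum>k\<in>?K. (a - real k) * ?b k) + (\<Sum>k\<in>{..m} - ?K. (a - real k) * ?b k)"
      by (subst sum.subset_diff[of ?K]) auto
    moreover have "(\<Sum>k\<in>{..m} - ?K. (a - real k) * ?b k) \<le> 0"
      using nn by (intro sum_nonpos mult_nonpos_nonneg) auto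
    ultimately show ?thesis by simp
  qed
  finally have "(real m * d)\<^sup>2 \<le> (\<Sum>k\<in>?K. sqrt (?b k) * ((a - real k) * sqrt (?b k)))\<^sup>2"
    using d nn by (intro power_mono) (auto simp: mult.left_commute mult.commute)
  also have "\<dots> \<le> (\<Sum>k\<in>?K. (sqrt (?b k))\<^sup>2) * (\<Sum>k\<in>?K. ((a - real k) * sqrt (?b k))\<^sup>2)"
    by (rule Cauchy_Schwarz_ineq_sum)
  also have "\<dots> = lower_tail m s a * (\<Sum>k\<in>?K. (a - real k)\<^sup>2 * ?b k)"
    using nn s by (simp add: power_mult_distrib lower_tail_sum)
  also have "\<dots> \<le> lower_tail m s a * (\<Sum>k\<le>m. (a - real k)\<^sup>2 * ?b k)"
    using nn by (intro mult_left_mono sum_mono2 lower_tail_nonneg) auto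
  finally show ?thesis unfolding second unfolding a_def .
qed

section \<open>Thresholds of the tests\<close>

lemma p_grid_cases:
  assumes "m \<ge> 1" "q \<in> p_grid m" "q \<noteq> 1"
  shows "q = 0 \<or> (1 / real m \<le> q \<and> q \<le> 1 - 1 / real m)"
proof -
  obtain k where k: "k \<le> m" "q = real k / real m"
    using assms(2) by (auto simp: p_grid_def)
  have "k \<noteq> m" using k assms by auto
  then have "real k + 1 \<le> real m" using k(1) by linarith
  then show ?thesis
    using k assms(1) by (cases "k = 0") (auto simp: field_simps)
qed

text \<open>
  Here \<open>q - \<delta>\<close> and \<open>r\<close> are the threshold and the separation of the test at an interior grid point, and
  \<open>D\<close> stands for \<open>ln (1 / A)\<close>. The dimensionless quantity \<open>u = m \<delta>\<^sup>2 / (q (1 - q))\<close> satisfies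
  \<open>1 / 8 \<le> u \<le> D / 64\<close>: the lower bound says that the threshold is at least a constant number of
  standard deviations below the mean, the upper bound limits how small the tail can be. The lower bound
  for the tail compares \<open>q + r\<close> with \<open>s = q - 2 \<delta>\<close>, under which the tail up to \<open>m (q - \<delta>)\<close> has
  probability at least \<open>1 / 17\<close>.
\<close>

lemma deviation_bounds:
  fixes q D :: real and m :: nat
  defines "w \<equiv> q * (1 - q)"
  defines "\<delta> \<equiv> min (w / 2) (1 / 8 * sqrt (w * D / real m))"
  defines "r \<equiv> w / (4 * real m * \<delta>)"
  assumes m: "m \<ge> 1" and q: "1 / real m \<le> q" "q \<le> 1 - 1 / real m" and D: "D \<ge> 64"
  shows "0 < \<delta>" "0 \<le> r" "r \<le> (1 - q) / 2"
    "r \<le> 1 / (2 * real m) + 2 * sqrt (w / (real m * D))"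
    "lower_tail m (q + r) (real m * (q - \<delta>)) \<le> exp (- 1 / 4) * lower_tail m q (real m * (q - \<delta>))"
    "exp (- 3) / 289 * exp (- D / 8) \<le> lower_tail m (q + r) (real m * (q - \<delta>))"
proof -
  have m0: "real m > 0" using m by simp
  have q01: "0 < q" "q < 1"
  proof -
    have "0 < 1 / real m" using m0 by simp
    then show "0 < q" "q < 1" using q by linarith+
  qed
  have w0: "0 < w" using q01 by (simp add: w_def)
  have wq: "w \<le> q" "w \<le> 1 - q"
    using q01 by (auto simp: w_def mult_left_le_one_le mult_left_le)
  have mq: "real m * q \<ge> 1" "real m * (1 - q) \<ge> 1"
    using q m0 by (auto simp: field_simps)
  have mw: "real m * w \<ge> 1 / 2"
  proof (cases "q \<le> 1 / 2")
    case True
    then have "1 * (1 / 2) \<le> (real m * q) * (1 - q)" using mq q01 by (intro mult_mono) auto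
    then show ?thesis by (simp add: w_def mult_ac)
  next
    case False
    then have "1 * (1 / 2) \<le> (real m * (1 - q)) * q" using mq q01 by (intro mult_mono) auto
    then show ?thesis by (simp add: w_def mult_ac)
  qed
  show \<delta>0: "0 < \<delta>" using w0 D m0 by (simp add: \<delta>_def)
  define u where "u = real m * \<delta>\<^sup>2 / w"
  have u_w: "real m * \<delta>\<^sup>2 = u * w" using w0 by (simp add: u_def)
  have u0: "0 < u" using \<delta>0 w0 m0 by (simp add: u_def)
  have r_u: "r = \<delta> / (4 * u)"
    using \<delta>0 w0 m0 by (simp add: r_def u_def power2_eq_square)
  show r0: "0 \<le> r" using \<delta>0 w0 m0 by (simp add: r_def)
  have \<delta>w: "\<delta> \<le> w / 2" by (simp add: \<delta>_def)
  \<comment> \<open>The two cases are the two branches of the minimum that defines \<open>\<delta>\<close>.\<close>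
  have "(\<delta> = w / 2 \<and> u = real m * w / 4 \<and> u \<le> D / 64 \<and> r = 1 / (2 * real m)) \<or>
     (u = D / 64 \<and> r = 2 * sqrt (w / (real m * D)))"
  proof (cases "w / 2 \<le> 1 / 8 * sqrt (w * D / real m)")
    case True
    then have \<delta>: "\<delta> = w / 2" by (simp add: \<delta>_def)
    have "(w / 2)\<^sup>2 \<le> (1 / 8 * sqrt (w * D / real m))\<^sup>2"
      using True w0 by (intro power_mono) auto
    also have "\<dots> = w * D / (64 * real m)"
      using w0 D m0 by (simp add: power_mult_distrib power_divide)
    finally have "real m * (w / 2)\<^sup>2 / w \<le> D / 64"
      using w0 m0 by (simp add: field_simps)
    then have "u \<le> D / 64" by (simp add: u_def \<delta>)
    moreover have "u = real m * w / 4" using w0 by (simp add: u_def \<delta> power2_eq_square)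
    moreover have "r = 1 / (2 * real m)" using w0 m0 by (simp add: r_def \<delta>)
    ultimately show ?thesis using \<delta> by blast
  next
    case False
    then have \<delta>: "\<delta> = 1 / 8 * sqrt (w * D / real m)" by (simp add: \<delta>_def)
    have "u = D / 64"
      using w0 D m0 by (simp add: u_def \<delta> power_mult_distrib power_divide)
    moreover have "r = 2 * sqrt (w / (real m * D))"
    proof -
      have "sqrt (w / (real m * D)) * sqrt (w * D / real m) = sqrt ((w / real m)\<^sup>2)"
        using D m0 by (simp add: power2_eq_square flip: real_sqrt_mult)
      also have "\<dots> = w / real m" using w0 m0 by (subst real_sqrt_abs) simp
      finally have "2 * sqrt (w / (real m * D)) * (4 * real m * \<delta>) = w"
        using m0 by (simp add: \<delta> mult_ac)
      then show ?thesis unfolding r_def using m0 \<delta>0 by (simp add: divide_eq_eq mult_ac)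
    qed
    ultimately show ?thesis by simp
  qed
  then have u8: "1 / 8 \<le> u" and uD: "u \<le> D / 64"
    and r_half: "r \<le> (1 - q) / 2"
    and r_le: "r \<le> 1 / (2 * real m) + 2 * sqrt (w / (real m * D))"
  proof (atomize (full), elim disjE conjE, goal_cases)
    case 1
    have "1 / real m \<le> 1 - q" using q by simp
    then have "1 / (2 * real m) \<le> (1 - q) / 2" by simp
    then show ?case using 1 mw w0 m0 D by simp
  next
    case 2
    have "u = D / 64" using 2 by blast
    then have "r = \<delta> / (4 * (D / 64))" unfolding r_u by (simp only:)
    then have "r = 16 * \<delta> / D" by simp
    also have "16 * \<delta> / D \<le> 16 * (w / 2) / D" using \<delta>w D by (intro divide_right_mono) auto
    also have "\<dots> \<le> 16 * (w / 2) / 64" using w0 D by (intro divide_left_mono) auto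
    also have "\<dots> \<le> (1 - q) / 2"
      using wq q01 by simp
    finally have "r \<le> (1 - q) / 2" .
    then show ?case using 2 D m0 by simp
  qed
  show "r \<le> (1 - q) / 2" "r \<le> 1 / (2 * real m) + 2 * sqrt (w / (real m * D))"
    by fact+
  have quarter: "real m * r * (q - (q - \<delta>)) / (q * (1 - q)) = 1 / 4"
    using m0 \<delta>0 q01 by (simp add: r_def w_def)
  show "lower_tail m (q + r) (real m * (q - \<delta>)) \<le> exp (- 1 / 4) * lower_tail m q (real m * (q - \<delta>))"
    using lower_tail_tilt_le[of q r m "q - \<delta>", unfolded quarter] q01 r0 r_half by simp
  \<comment> \<open>The comparison parameter lies as far below the threshold as \<open>q\<close> lies above it.\<close>
  define s where "s = q - 2 * \<delta>"
  have s: "0 \<le> s" "s \<le> q" "1 - s \<le> 2 * (1 - q)"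
    using wq \<delta>w \<delta>0 by (auto simp: s_def)
  define R where "R = lower_tail m s (real m * (q - \<delta>))"
  have "(real m * \<delta>)\<^sup>2 \<le> R * (real m * s * (1 - s) + (real m * \<delta>)\<^sup>2)"
    using lower_tail_Cantelli[of s \<delta> m] s q01 \<delta>0 by (simp add: R_def s_def)
  also have "\<dots> \<le> R * (real m * (2 * w) + (real m * \<delta>)\<^sup>2)"
  proof -
    have "s * (1 - s) \<le> q * (2 * (1 - q))"
      using s q01 by (intro mult_mono) auto
    also have "q * (2 * (1 - q)) = 2 * w" by (simp only: w_def mult_ac)
    finally have "real m * (s * (1 - s)) \<le> real m * (2 * w)" by (intro mult_left_mono) auto
    then show ?thesis
      by (intro mult_left_mono add_right_mono) (auto simp: R_def lower_tail_nonneg mult_ac)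
  qed
  also have "(real m * \<delta>)\<^sup>2 = real m * (u * w)"
    by (simp add: power_mult_distrib u_w[symmetric] power2_eq_square)
  finally have "(real m * w) * u \<le> (real m * w) * (R * (2 + u))"
    by (simp add: algebra_simps)
  then have "u \<le> R * (2 + u)" using w0 m0 by simp
  moreover have "2 + u \<le> 17 * u" using u8 by simp
  moreover have "0 \<le> R" by (simp add: R_def lower_tail_nonneg)
  ultimately have "u \<le> R * (17 * u)" by (meson mult_left_mono order_trans)
  then have R: "1 / 17 \<le> R" using u0 by simp
  define \<theta> where "\<theta> = q + r"
  have \<theta>: "0 < \<theta>" "\<theta> < 1" using q01 r0 r_half by (auto simp: \<theta>_def)
  have \<theta>w: "w / 2 \<le> \<theta> * (1 - \<theta>)"
  proof -
    have "q * ((1 - q) / 2) \<le> \<theta> * (1 - \<theta>)"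
      using q01 r0 r_half by (intro mult_mono) (auto simp: \<theta>_def)
    then show ?thesis by (simp add: w_def)
  qed
  have "\<theta> - s = \<delta> * (2 + 1 / (4 * u))"
    by (simp add: \<theta>_def s_def r_u distrib_left)
  then have "real m * (\<theta> - s)\<^sup>2 = u * w * (2 + 1 / (4 * u))\<^sup>2"
    by (simp add: power_mult_distrib u_w[symmetric])
  then have "real m * (\<theta> - s)\<^sup>2 / (\<theta> * (1 - \<theta>)) \<le> u * w * (2 + 1 / (4 * u))\<^sup>2 / (w / 2)"
    using \<theta>w w0 u0 \<theta> by (simp only:, intro divide_left_mono mult_pos_pos) auto
  also have "\<dots> = 8 * u + 2 + 1 / (8 * u)"
    using u0 w0 by (simp add: field_simps power2_eq_square)
  also have "\<dots> \<le> D / 8 + 3"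
  proof -
    have "1 / (8 * u) \<le> 1" using u8 u0 by simp
    then show ?thesis using uD by simp
  qed
  finally have E: "exp (real m * (\<theta> - s)\<^sup>2 / (\<theta> * (1 - \<theta>))) \<le> exp (D / 8 + 3)" by simp
  have "(1 / 17)\<^sup>2 \<le> R\<^sup>2" using R by (intro power_mono) auto
  also have "\<dots> \<le> lower_tail m \<theta> (real m * (q - \<delta>)) * exp (real m * (\<theta> - s)\<^sup>2 / (\<theta> * (1 - \<theta>)))"
    unfolding R_def using s q01 \<theta> by (intro lower_tail_chi_square) auto
  also have "\<dots> \<le> lower_tail m \<theta> (real m * (q - \<delta>)) * exp (D / 8 + 3)"
    using E by (intro mult_left_mono lower_tail_nonneg)
  finally have "(1 / 17)\<^sup>2 * exp (- (D / 8 + 3)) \<le> lower_tail m \<theta> (real m * (q - \<delta>)) * exp (D / 8 + 3) * exp (- (D / 8 + 3))"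
    by (intro mult_right_mono) auto
  also have "\<dots> = lower_tail m \<theta> (real m * (q - \<delta>))"
    by (simp flip: exp_add)
  finally have "(1 / 17)\<^sup>2 * exp (- (D / 8 + 3)) \<le> lower_tail m \<theta> (real m * (q - \<delta>))" .
  moreover have "exp (- (D / 8 + 3)) = exp (- 3) * exp (- D / 8)"
    by (subst exp_add[symmetric]) simp
  ultimately show "exp (- 3) / 289 * exp (- D / 8) \<le> lower_tail m (q + r) (real m * (q - \<delta>))"
    by (simp add: \<theta>_def power2_eq_square)
qed

text \<open>
  The same bounds for the functions of the algorithm, now including \<open>q = 0\<close>. There the threshold is
  \<open>0\<close>, the separation is \<open>1 / (2 m)\<close>, and the tail is \<open>(1 - 1 / (2 m))\<^sup>m\<close>, which lies between \<open>1 / 2\<close> and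
  \<open>exp (- 1 / 2)\<close>.
\<close>

lemma threshold_bounds:
  fixes \<alpha> \<epsilon> q :: real and n m :: nat
  defines "D \<equiv> ln (1 / level \<alpha> n \<epsilon>)"
  defines "t \<equiv> t_upper \<alpha> n m q \<epsilon>" and "r \<equiv> r_upper \<alpha> n m q \<epsilon>"
  assumes m: "m \<ge> 1" and q: "q \<in> p_grid m" "q \<noteq> 1" and D: "D \<ge> 64"
  shows "0 \<le> q" "q \<le> 1 - 1 / real m" "t \<le> q" "0 \<le> r" "r \<le> (1 - q) / 2"
    "r \<le> 1 / (2 * real m) + 2 * sqrt (q * (1 - q) / (real m * D))"
    "lower_tail m (q + r) (real m * t) \<le> exp (- 1 / 4) * lower_tail m q (real m * t)"
    "exp (- 3) / 289 * exp (- D / 8) \<le> lower_tail m (q + r) (real m * t)"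
    "tau_upper \<alpha> n m q \<epsilon> = 11 / 10 * lower_tail m (q + r) (real m * t)"
proof -
  have m0: "real m > 0" using m by simp
  have *: "0 \<le> q \<and> q \<le> 1 - 1 / real m \<and> t \<le> q \<and> 0 \<le> r \<and> r \<le> (1 - q) / 2 \<and>
    r \<le> 1 / (2 * real m) + 2 * sqrt (q * (1 - q) / (real m * D)) \<and>
    lower_tail m (q + r) (real m * t) \<le> exp (- 1 / 4) * lower_tail m q (real m * t) \<and>
    exp (- 3) / 289 * exp (- D / 8) \<le> lower_tail m (q + r) (real m * t)"
  proof (cases "q = 0")
    case True
    have t: "t = 0" using True m m0 by (simp add: t_def t_upper_def)
    have r: "r = 1 / (2 * real m)" using True by (simp add: r_def r_upper_def)
    have r1: "0 \<le> r" "r \<le> 1 / 2" using m m0 by (auto simp: r field_simps)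
    have tail: "lower_tail m r 0 = (1 - r) ^ m" "lower_tail m 0 0 = 1"
      using r1 lower_tail_zero[of r m] lower_tail_zero[of 0 m] by auto
    have "(1 - r) ^ m \<le> exp (- r) ^ m"
      using r1 exp_ge_add_one_self[of "- r"] by (intro power_mono) auto
    also have "\<dots> = exp (- 1 / 2)"
      using m0 by (simp add: r flip: exp_of_nat_mult)
    also have "\<dots> \<le> exp (- 1 / 4)" by simp
    finally have up: "(1 - r) ^ m \<le> exp (- 1 / 4)" .
    have "1 + real m * (- r) \<le> (1 + (- r)) ^ m"
      using r1 by (intro Bernoulli_inequality) auto
    then have "1 / 2 \<le> (1 - r) ^ m" using m0 by (simp add: r)
    moreover have "exp (- 3) / 289 * exp (- D / 8) \<le> 1 / 289 * (1 :: real)"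
      using D by (intro mult_mono divide_right_mono) auto
    ultimately have "exp (- 3) / 289 * exp (- D / 8) \<le> (1 - r) ^ m" by linarith
    moreover have "r \<le> 1 / (2 * real m)" "1 / real m \<le> 1" using r m by auto
    ultimately show ?thesis using up r1 unfolding t True by (auto simp: tail)
  next
    case False
    then have q': "1 / real m \<le> q" "q \<le> 1 - 1 / real m"
      using p_grid_cases[OF m q] by auto
    have q01: "0 < q" using q' m0 by (smt (verit) zero_less_divide_1_iff)
    let ?\<delta> = "min (q * (1 - q) / 2) (1 / 8 * sqrt (q * (1 - q) * D / real m))"
    have t: "t = q - ?\<delta>" using q' by (simp add: t_def t_upper_def D_def)
    have r: "r = q * (1 - q) / (4 * real m * ?\<delta>)"
      using q' q01 False unfolding r_def r_upper_def t_def[symmetric] by (simp add: t)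
    show ?thesis
      using deviation_bounds[OF m q' D] q' q01 unfolding t r by simp
  qed
  then show "0 \<le> q" "q \<le> 1 - 1 / real m" "t \<le> q" "0 \<le> r" "r \<le> (1 - q) / 2"
    "r \<le> 1 / (2 * real m) + 2 * sqrt (q * (1 - q) / (real m * D))"
    "lower_tail m (q + r) (real m * t) \<le> exp (- 1 / 4) * lower_tail m q (real m * t)"
    "exp (- 3) / 289 * exp (- D / 8) \<le> lower_tail m (q + r) (real m * t)"
    by blast+
  show "tau_upper \<alpha> n m q \<epsilon> = 11 / 10 * lower_tail m (q + r) (real m * t)"
    using * by (simp add: tau_upper_def lower_tail_def t_def r_def)
qed

section \<open>Output of the algorithm\<close>

text \<open>
  The fraction of the observations \<open>X 1, \<dots>, X n\<close> that lie in \<open>A\<close>.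
\<close>

definition empirical :: "nat \<Rightarrow> (nat \<Rightarrow> real) \<Rightarrow> real set \<Rightarrow> real" where
  "empirical n X A = 1 / real n * (\<Sum>i=1..n. of_bool (X i \<in> A))"

lemma empirical_mono: "A \<subseteq> B \<Longrightarrow> empirical n X A \<le> empirical n X B"
  unfolding empirical_def by (intro mult_left_mono sum_mono) auto

lemma empirical_nonneg: "0 \<le> empirical n X A"
  unfolding empirical_def by (intro mult_nonneg_nonneg sum_nonneg) auto

lemma left_init_empirical:
  "left_init \<alpha> n m X =
     max (root m (1 - min (2 * empirical n X {..real m - 1} + 6 * ln (24 / \<alpha>) / real n) 1)) (1 - 1 / real m)"
  by (simp add: left_init_def empirical_def)

text \<open>
  The condition under which the first loop moves the left endpoint to \<open>p\<close>: at every contamination level of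
  the grid, some grid point \<open>q \<le> p + 1 / m\<close> other than \<open>1\<close> is not rejected.
\<close>

definition left_ok :: "real \<Rightarrow> nat \<Rightarrow> nat \<Rightarrow> real \<Rightarrow> (nat \<Rightarrow> real) \<Rightarrow> real \<Rightarrow> bool" where
  "left_ok \<alpha> n m e X p \<longleftrightarrow> (\<forall>\<epsilon>\<in>eps_grid \<alpha> n e. \<exists>q\<in>{0..p + 1 / real m} \<inter> (p_grid m - {1}).
     tau_upper \<alpha> n m q \<epsilon> \<le> empirical n X {..real m * t_upper \<alpha> n m q \<epsilon>})"

lemma finite_p_grid [simp]: "finite (p_grid m)"
  by (simp add: p_grid_def)

lemma finite_eps_grid [simp]: "finite (eps_grid \<alpha> n e)"
proof -
  let ?b = "\<lfloor>log 2 (real n * e / ln (24 / \<alpha>))\<rfloor>"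
  have "{2 ^ k * ln (24 / \<alpha>) / real n | k :: nat. e > 0 \<and> int k \<le> ?b} \<subseteq>
      (\<lambda>k. 2 ^ k * ln (24 / \<alpha>) / real n) ` {..nat ?b}"
    by auto
  then have "finite {2 ^ k * ln (24 / \<alpha>) / real n | k :: nat. e > 0 \<and> int k \<le> ?b}"
    by (rule finite_subset) simp
  then show ?thesis by (simp add: eps_grid_def)
qed

lemma eps_grid_nonempty: "e \<in> eps_grid \<alpha> n e"
  by (simp add: eps_grid_def)

lemma of_bool_Max_Min_eq_0:
  assumes "finite E" "E \<noteq> {}" "finite A" "A \<noteq> {}"
  shows "(MAX \<epsilon>\<in>E. MIN q\<in>A. of_bool (P q \<epsilon>) :: real) = 0 \<longleftrightarrow> (\<forall>\<epsilon>\<in>E. \<exists>q\<in>A. \<not> P q \<epsilon>)"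
proof -
  have Min: "(MIN q\<in>A. of_bool (P q \<epsilon>) :: real) = of_bool (\<forall>q\<in>A. P q \<epsilon>)" for \<epsilon>
    using assms by (intro Min_eqI) (auto simp: image_iff)
  have "(MAX \<epsilon>\<in>E. MIN q\<in>A. of_bool (P q \<epsilon>) :: real) = of_bool (\<exists>\<epsilon>\<in>E. \<forall>q\<in>A. P q \<epsilon>)"
    unfolding Min using assms by (intro Max_eqI) (auto simp: image_iff)
  then show ?thesis by auto
qed

lemma left_step_eq:
  assumes m: "m \<ge> 1" and p: "0 \<le> p"
  shows "left_step \<alpha> n m e X (p, l) =
     (p - 1 / real m, if left_ok \<alpha> n m e X (p - 1 / real m) then p - 1 / real m else l)"
proof -
  have "0 \<in> p_grid m" unfolding p_grid_def by (rule image_eqI[of _ _ 0]) auto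
  then have ne: "{0..p - 1 / real m + 1 / real m} \<inter> (p_grid m - {1}) \<noteq> {}"
    using p by (intro ex_in_conv[THEN iffD1] exI[of _ 0]) simp
  show ?thesis
    unfolding left_step_def test_plus_def Let_def prod.case left_ok_def
    by (subst of_bool_Max_Min_eq_0)
       (use ne eps_grid_nonempty[of e \<alpha> n] in \<open>auto simp: empirical_def not_less\<close>)
qed

text \<open>
  Loop invariant: after \<open>j\<close> steps the endpoint is the last value \<open>1 - i / m\<close> at which the condition held, or
  still the initial value if there was none.
\<close>

lemma fold_left_step:
  fixes \<alpha> e l :: real and X :: "nat \<Rightarrow> real" and n m j :: nat
  assumes m: "m \<ge> 1" and j: "j \<le> m"
  defines "st \<equiv> fold (\<lambda>_. left_step \<alpha> n m e X) [1..<Suc j] (1, l)"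
  shows "fst st = 1 - real j / real m \<and>
    ((snd st = l \<and> (\<forall>i\<in>{1..j}. \<not> left_ok \<alpha> n m e X (1 - real i / real m))) \<or>
     (\<exists>i\<in>{1..j}. snd st = 1 - real i / real m \<and> left_ok \<alpha> n m e X (1 - real i / real m) \<and>
        (\<forall>i'\<in>{i<..j}. \<not> left_ok \<alpha> n m e X (1 - real i' / real m))))"
  using j unfolding st_def
proof (induction j)
  case 0
  then show ?case by simp
next
  case (Suc j)
  define s where "s = fold (\<lambda>_. left_step \<alpha> n m e X) [1..<Suc j] (1, l)"
  define p where "p = 1 - real (Suc j) / real m"
  have IH: "fst s = 1 - real j / real m"
    "(snd s = l \<and> (\<forall>i\<in>{1..j}. \<not> left_ok \<alpha> n m e X (1 - real i / real m))) \<or>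
     (\<exists>i\<in>{1..j}. snd s = 1 - real i / real m \<and> left_ok \<alpha> n m e X (1 - real i / real m) \<and>
        (\<forall>i'\<in>{i<..j}. \<not> left_ok \<alpha> n m e X (1 - real i' / real m)))"
    using Suc by (auto simp: s_def)
  have "fold (\<lambda>_. left_step \<alpha> n m e X) [1..<Suc (Suc j)] (1, l) = left_step \<alpha> n m e X (fst s, snd s)"
    by (simp add: s_def)
  also have "\<dots> = (fst s - 1 / real m, if left_ok \<alpha> n m e X (fst s - 1 / real m) then fst s - 1 / real m else snd s)"
    using m Suc.prems by (intro left_step_eq) (auto simp: IH(1))
  also have "fst s - 1 / real m = p"
    using m by (simp add: IH(1) p_def field_simps)
  finally have eq: "fold (\<lambda>_. left_step \<alpha> n m e X) [1..<Suc (Suc j)] (1, l) =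
      (p, if left_ok \<alpha> n m e X p then p else snd s)" .
  have ex: "\<exists>i\<in>{1..Suc j}. P i" if "P (Suc j)" for P using that by auto
  show ?case
  proof (cases "left_ok \<alpha> n m e X p")
    case True
    show ?thesis unfolding eq
      by (intro conjI disjI2 ex) (use True in \<open>auto simp: p_def\<close>)
  next
    case False
    have "{1..Suc j} = insert (Suc j) {1..j}" by auto
    moreover have "{i<..Suc j} = insert (Suc j) {i<..j}" if "i \<in> {1..j}" for i using that by auto
    ultimately show ?thesis unfolding eq using False IH(2)
      by (auto simp: p_def)
  qed
qed

lemma ci_left_eq:
  "ci_left \<alpha> n m e X = snd (fold (\<lambda>_. left_step \<alpha> n m e X) [1..<Suc m] (1, left_init \<alpha> n m X))"
  by (simp add: ci_left_def ci_endpoints_def split: prod.splits)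

lemma ci_left_cases:
  assumes m: "m \<ge> 1"
  shows "(ci_left \<alpha> n m e X = left_init \<alpha> n m X \<and> (\<forall>i\<in>{1..m}. \<not> left_ok \<alpha> n m e X (1 - real i / real m))) \<or>
     (\<exists>i\<in>{1..m}. ci_left \<alpha> n m e X = 1 - real i / real m \<and> left_ok \<alpha> n m e X (1 - real i / real m) \<and>
        (\<forall>i'\<in>{i<..m}. \<not> left_ok \<alpha> n m e X (1 - real i' / real m)))"
  using fold_left_step[OF m order_refl, of \<alpha> n e X "left_init \<alpha> n m X"]
  unfolding ci_left_eq by blast

lemma ci_left_le_left_init:
  assumes m: "m \<ge> 1"
  shows "ci_left \<alpha> n m e X \<le> left_init \<alpha> n m X"
proof -
  have "1 - real i / real m \<le> left_init \<alpha> n m X" if "i \<in> {1..m}" for i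
  proof -
    have "1 - real i / real m \<le> 1 - 1 / real m" using that by (simp add: divide_right_mono)
    also have "\<dots> \<le> left_init \<alpha> n m X" by (simp add: left_init_def)
    finally show ?thesis .
  qed
  then show ?thesis using ci_left_cases[OF m, of \<alpha> n e X] by force
qed


lemma one_minus_p_grid:
  assumes "m \<ge> 1"
  shows "(\<lambda>q. 1 - q) ` p_grid m = p_grid m"
proof -
  have sub: "(\<lambda>q. 1 - q) ` p_grid m \<subseteq> p_grid m"
  proof safe
    fix q assume "q \<in> p_grid m"
    then obtain k where "k \<le> m" "q = real k / real m" by (auto simp: p_grid_def)
    then show "1 - q \<in> p_grid m"
      using assms unfolding p_grid_def
      by (intro image_eqI[of _ _ "m - k"]) (auto simp: of_nat_diff field_simps)
  qed
  have "p_grid m \<subseteq> (\<lambda>q. 1 - q) ` p_grid m"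
  proof (intro subsetI)
    fix q assume "q \<in> p_grid m"
    then have "1 - q \<in> p_grid m" using sub by blast
    then show "q \<in> (\<lambda>q. 1 - q) ` p_grid m" by (rule rev_image_eqI) simp
  qed
  then show ?thesis using sub by blast
qed

text \<open>
  The second half of the algorithm is the first half run on the reflected sample \<open>m - X\<close>, with \<open>q\<close> replaced
  by \<open>1 - q\<close>. Hence everything below is shown for the left endpoint only.
\<close>

lemma test_minus_reflect:
  "test_minus \<alpha> n m X q \<epsilon> = test_plus \<alpha> n m (\<lambda>i. real m - X i) (1 - q) \<epsilon>"
proof -
  have "(X i \<ge> real m * (1 - t)) = (real m - X i \<le> real m * t)" for i t
    by (simp add: algebra_simps)
  then show ?thesis by (simp add: test_minus_def test_plus_def t_lower_def tau_lower_def)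
qed

lemma right_init_reflect:
  "right_init \<alpha> n m X = 1 - left_init \<alpha> n m (\<lambda>i. real m - X i)"
proof -
  have "(X i \<ge> 1) = (real m - X i \<le> real m - 1)" for i by auto
  then show ?thesis by (simp add: right_init_def left_init_def min_def max_def)
qed

lemma right_step_reflect:
  assumes m: "m \<ge> 1"
  shows "right_step \<alpha> n m e X (1 - p, 1 - r) =
     map_prod (\<lambda>x. 1 - x) (\<lambda>x. 1 - x) (left_step \<alpha> n m e (\<lambda>i. real m - X i) (p, r))"
proof -
  define a where "a = 1 / real m"
  have "{0..p - a + a} \<inter> (p_grid m - {1}) = (\<lambda>q. 1 - q) ` ({1 - p + a - a..1} \<inter> (p_grid m - {0}))"
  proof -
    have "(\<lambda>q. 1 - q) ` ({1 - p..1} \<inter> (p_grid m - {0})) =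
        (\<lambda>q. 1 - q) ` {1 - p..1} \<inter> ((\<lambda>q. 1 - q) ` p_grid m - (\<lambda>q. 1 - q) ` {0})"
      by (simp add: image_Int image_set_diff inj_def)
    then show ?thesis using one_minus_p_grid[OF m] by simp
  qed
  then show ?thesis
    unfolding right_step_def left_step_def Let_def prod.case a_def[symmetric]
    by (simp add: image_image test_minus_reflect)
qed

lemma fold_right_step_reflect:
  assumes m: "m \<ge> 1"
  shows "fold (\<lambda>_. right_step \<alpha> n m e X) xs (1 - p, 1 - r) =
     map_prod (\<lambda>x. 1 - x) (\<lambda>x. 1 - x) (fold (\<lambda>_. left_step \<alpha> n m e (\<lambda>i. real m - X i)) xs (p, r))"
proof (induction xs arbitrary: p r)
  case Nil
  then show ?case by simp
next
  case (Cons x xs)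
  obtain p' r' where "left_step \<alpha> n m e (\<lambda>i. real m - X i) (p, r) = (p', r')" by fastforce
  then show ?case using Cons.IH by (simp add: right_step_reflect[OF m])
qed

lemma ci_right_reflect:
  assumes m: "m \<ge> 1"
  shows "ci_right \<alpha> n m e X = 1 - ci_left \<alpha> n m e (\<lambda>i. real m - X i)"
proof -
  have fst: "fst (fold (\<lambda>_. left_step \<alpha> n m e X) [1..<Suc m] (1, left_init \<alpha> n m X)) = 1 - 1"
    using fold_left_step[OF m order_refl, of \<alpha> n e X "left_init \<alpha> n m X"] m by simp
  have "ci_right \<alpha> n m e X = snd (fold (\<lambda>_. right_step \<alpha> n m e X) [1..<Suc m]
      (fst (fold (\<lambda>_. left_step \<alpha> n m e X) [1..<Suc m] (1, left_init \<alpha> n m X)), right_init \<alpha> n m X))"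
    by (simp add: ci_right_def ci_endpoints_def split: prod.splits)
  then show ?thesis
    unfolding fst right_init_reflect fold_right_step_reflect[OF m] ci_left_eq by (simp del: upt_Suc)
qed

section \<open>Coverage and length for well-behaved samples\<close>

lemma eps_grid_bounds:
  assumes n: "n \<ge> 1" and L: "0 < ln (24 / \<alpha>)" and e: "0 \<le> e" and x: "x \<in> eps_grid \<alpha> n e"
  shows "0 \<le> x" "x \<le> e"
proof -
  have "0 \<le> x \<and> x \<le> e"
  proof (cases "x = e")
    case False
    then obtain k :: nat where k: "x = 2 ^ k * ln (24 / \<alpha>) / real n" "e > 0"
      "int k \<le> \<lfloor>log 2 (real n * e / ln (24 / \<alpha>))\<rfloor>"
      using x by (auto simp: eps_grid_def)
    have "real k \<le> log 2 (real n * e / ln (24 / \<alpha>))" using k(3) by (simp add: le_floor_iff)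
    then have "2 powr real k \<le> real n * e / ln (24 / \<alpha>)"
      using n L k(2) by (subst (asm) le_log_iff) auto
    then have "2 ^ k * ln (24 / \<alpha>) \<le> real n * e" using L by (simp add: powr_realpow field_simps)
    then show ?thesis using n L unfolding k(1) by (simp add: field_simps)
  qed (use e in simp)
  then show "0 \<le> x" "x \<le> e" by auto
qed

text \<open>
  A contamination level of the grid that is valid for the true \<open>\<epsilon>\<close> and exceeds it at most by a factor of two,
  or else is of the order \<open>1 / n\<close>.
\<close>

lemma eps_grid_near:
  assumes n: "n \<ge> 1" and L: "0 < ln (24 / \<alpha>)" and \<epsilon>: "0 \<le> \<epsilon>" "\<epsilon> \<le> e"
  shows "\<exists>x\<in>eps_grid \<alpha> n e. \<epsilon> \<le> x \<and> x \<le> max (2 * \<epsilon>) (ln (24 / \<alpha>) / real n)"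
proof (cases "e \<le> max (2 * \<epsilon>) (ln (24 / \<alpha>) / real n)")
  case True
  then show ?thesis using \<epsilon> eps_grid_nonempty by blast
next
  case False
  define a where "a = ln (24 / \<alpha>) / real n"
  have a: "0 < a" using n L by (simp add: a_def)
  have e: "2 * \<epsilon> < e" "a < e" using False by (auto simp: a_def)
  have mem: "2 ^ k * a \<in> eps_grid \<alpha> n e" if "2 ^ k * a \<le> e" for k :: nat
  proof -
    have "2 powr real k \<le> real n * e / ln (24 / \<alpha>)"
      using that n L by (simp add: a_def powr_realpow field_simps)
    then have "real k \<le> log 2 (real n * e / ln (24 / \<alpha>))"
      using n L e a by (subst le_log_iff) auto
    then have "int k \<le> \<lfloor>log 2 (real n * e / ln (24 / \<alpha>))\<rfloor>" by (simp add: le_floor_iff)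
    then show ?thesis using e a by (auto simp: eps_grid_def a_def)
  qed
  show ?thesis
  proof (cases "\<epsilon> \<le> a")
    case True
    then show ?thesis using mem[of 0] e by (intro bexI[of _ "2 ^ 0 * a"]) (auto simp: a_def)
  next
    case False
    define k where "k = nat \<lceil>log 2 (\<epsilon> / a)\<rceil>"
    have l0: "0 < log 2 (\<epsilon> / a)" using False a by simp
    have "log 2 (\<epsilon> / a) \<le> real k" "real k \<le> log 2 (\<epsilon> / a) + 1"
      using l0 unfolding k_def by linarith+
    then have "\<epsilon> / a \<le> 2 powr real k" "2 powr real k \<le> 2 powr (log 2 (\<epsilon> / a) + 1)"
      using False a by (auto simp: log_le_iff)
    moreover have "2 powr (log 2 (\<epsilon> / a) + 1) = 2 * (\<epsilon> / a)"
      using False a by (simp add: powr_add)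
    ultimately have "\<epsilon> / a \<le> 2 ^ k" "2 ^ k \<le> 2 * (\<epsilon> / a)"
      by (auto simp: powr_realpow)
    then have "\<epsilon> \<le> 2 ^ k * a" "2 ^ k * a \<le> 2 * \<epsilon>"
      using a by (auto simp: field_simps)
    then show ?thesis using mem[of k] e by (intro bexI[of _ "2 ^ k * a"]) auto
  qed
qed

lemma ln_24_div_ge_2:
  fixes \<alpha> :: real
  assumes \<alpha>: "0 < \<alpha>" "\<alpha> < 1"
  shows "2 \<le> ln (24 / \<alpha>)"
proof -
  have "exp (2 :: real) = exp 1 * exp 1" by (simp flip: exp_add)
  also have "\<dots> \<le> 3 * 3" using exp_le by (intro mult_mono) auto
  also have "\<dots> \<le> 24 / \<alpha>" using \<alpha> by (simp add: field_simps)
  finally show ?thesis using \<alpha> by (simp add: ln_ge_iff)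
qed

text \<open>
  A deterministic sample whose relevant empirical frequencies are close to their expectations. The bounds
  \<open>lower\<close> and \<open>upper\<close> are additive with the error \<open>2 sqrt (level \<alpha> n 0)\<close>, which is much larger than the
  standard error but still much smaller than the tail probabilities at the thresholds. The bounds
  \<open>edge_lower\<close> and \<open>edge_upper\<close> are relative, up to a multiple of \<open>1 / n\<close>; they are needed for the initial
  endpoint. Since contamination only adds mass, the lower bounds lose a factor \<open>1 - \<epsilon>\<close>, whereas the upper
  bounds gain the summand \<open>\<epsilon>\<close>. The parameter \<open>e\<close> is the bound on the contamination that the algorithm is given.
\<close>

locale good_sample =
  fixes \<alpha> e \<epsilon> p :: real and n m :: nat and X :: "nat \<Rightarrow> real"
  assumes \<alpha>: "0 < \<alpha>" "\<alpha> < 1" and m: "m \<ge> 1" and n: "n \<ge> 1"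
    and \<epsilon>: "0 \<le> \<epsilon>" "\<epsilon> \<le> e" and p: "0 \<le> p" "p \<le> 1"
    and small: "level \<alpha> n e \<le> exp (- 64)"
    and lower: "\<And>q \<epsilon>'. q \<in> p_grid m \<Longrightarrow> \<epsilon>' \<in> eps_grid \<alpha> n e \<Longrightarrow>
      (1 - \<epsilon>) * lower_tail m p (real m * t_upper \<alpha> n m q \<epsilon>') - 2 * sqrt (level \<alpha> n 0)
        \<le> empirical n X {..real m * t_upper \<alpha> n m q \<epsilon>'}"
    and upper: "\<And>q \<epsilon>'. q \<in> p_grid m \<Longrightarrow> \<epsilon>' \<in> eps_grid \<alpha> n e \<Longrightarrow>
      empirical n X {..real m * t_upper \<alpha> n m q \<epsilon>'}
        \<le> lower_tail m p (real m * t_upper \<alpha> n m q \<epsilon>') + \<epsilon> + 2 * sqrt (level \<alpha> n 0)"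
    and edge_lower: "3 / 5 * ((1 - \<epsilon>) * (1 - p ^ m)) - ln (24 / \<alpha>) / real n \<le> empirical n X {..real m - 1}"
    and edge_upper: "empirical n X {..real m - 1} \<le> 2 * (1 - p ^ m + \<epsilon>) + ln (24 / \<alpha>) / real n"
begin

abbreviation "L \<equiv> ln (24 / \<alpha>)"

lemma L: "2 \<le> L"
  using \<alpha> by (rule ln_24_div_ge_2)

lemma exp_minus_64_le: "exp (- 64 :: real) \<le> 1 / 65"
proof -
  have "65 \<le> exp (64 :: real)" using exp_ge_add_one_self[of "64 :: real"] by simp
  then show ?thesis by (simp add: exp_minus field_simps)
qed

lemma level_zero_pos: "0 < level \<alpha> n 0" using L n by (simp add: level_def)

lemma e_bounds: "0 \<le> e" "e \<le> 1 / 65" "level \<alpha> n 0 \<le> 1 / 65"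
proof -
  have "level \<alpha> n e = e + level \<alpha> n 0" by (simp add: level_def)
  then show "0 \<le> e" "e \<le> 1 / 65" "level \<alpha> n 0 \<le> 1 / 65"
    using \<epsilon> small level_zero_pos exp_minus_64_le by linarith+
qed

lemma L_div_n_le_1: "L / real n \<le> 1"
proof -
  have "(level \<alpha> n 0)\<^sup>2 \<le> (1 / 65)\<^sup>2" using level_zero_pos e_bounds by (intro power_mono) auto
  moreover have "(level \<alpha> n 0)\<^sup>2 = L / (2 * real n)" using L n by (simp add: level_def)
  ultimately have "L / (2 * real n) \<le> 1 / 2" by (simp add: power2_eq_square)
  then show ?thesis by (simp add: field_simps)
qed

lemma level_bounds:
  assumes "x \<in> eps_grid \<alpha> n e"
  shows "0 < level \<alpha> n x" "64 \<le> ln (1 / level \<alpha> n x)" "level \<alpha> n 0 \<le> level \<alpha> n x"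
proof -
  have x: "0 \<le> x" "x \<le> e" using eps_grid_bounds[of n \<alpha> e x] assms n L e_bounds by auto
  then show "level \<alpha> n 0 \<le> level \<alpha> n x" by (simp add: level_def)
  then show pos: "0 < level \<alpha> n x" using level_zero_pos by simp
  have "level \<alpha> n x \<le> exp (- 64)" using x small by (simp add: level_def)
  then have "exp 64 \<le> 1 / level \<alpha> n x" using pos by (simp add: exp_minus field_simps)
  then show "64 \<le> ln (1 / level \<alpha> n x)" using pos by (subst ln_ge_iff) auto
qed

text \<open>
  The errors are negligible against the tail: they are at most of the order \<open>exp (- D / 2)\<close>, where
  \<open>D = ln (1 / level \<alpha> n x)\<close>, while the tail is at least of the order \<open>exp (- D / 8)\<close>.
\<close>

lemma noise_le_lower_tail:
  assumes "x \<in> eps_grid \<alpha> n e"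
  shows "x + 2 * sqrt (level \<alpha> n 0) \<le> 1 / 100 * (exp (- 3) / 289 * exp (- ln (1 / level \<alpha> n x) / 8))"
proof -
  define D where "D = ln (1 / level \<alpha> n x)"
  have D: "64 \<le> D" and A: "level \<alpha> n x = exp (- D)"
    using level_bounds[OF assms] by (auto simp: D_def ln_div)
  have "x \<le> level \<alpha> n x" using level_zero_pos by (simp add: level_def)
  also have "\<dots> \<le> exp (- D / 2)" using D by (simp add: A)
  finally have 1: "x \<le> exp (- D / 2)" .
  have "sqrt (level \<alpha> n 0) \<le> sqrt (exp (- D))" using level_bounds(3)[OF assms] by (simp add: A)
  also have "\<dots> = exp (- D / 2)"
    by (rule real_sqrt_unique) (auto simp: power2_eq_square simp flip: exp_add)
  finally have "x + 2 * sqrt (level \<alpha> n 0) \<le> 3 * exp (- D / 2)" using 1 by simp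
  also have "\<dots> \<le> 3 * exp (- 24 + - D / 8)" using D by simp
  also have "\<dots> = 3 * exp (- 21) * (exp (- 3) * exp (- D / 8))" by (simp flip: exp_add)
  also have "\<dots> \<le> 1 / 28900 * (exp (- 3) * exp (- D / 8))"
  proof (intro mult_right_mono)
    have "(2 :: real) ^ 21 \<le> exp 1 ^ 21"
      using exp_ge_add_one_self[of "1 :: real"] by (intro power_mono) auto
    then have "86700 \<le> exp (21 :: real)" by (simp flip: exp_of_nat_mult)
    then show "3 * exp (- 21 :: real) \<le> 1 / 28900" by (simp add: exp_minus field_simps)
  qed simp
  finally show ?thesis by (simp add: D_def)
qed

text \<open>
  No grid point \<open>q < 1\<close> with \<open>p \<le> q\<close> is rejected, at any level of the grid, even a level below the true
  \<open>\<epsilon>\<close>: contamination decreases the left tail at most by the factor \<open>1 - \<epsilon>\<close>, and the gap between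
  \<open>11 / 10 exp (- 1 / 4)\<close> and \<open>1\<close> absorbs this factor and the sampling error.
\<close>

lemma test_accepts:
  assumes q: "q \<in> p_grid m" "q \<noteq> 1" "p \<le> q" and x: "x \<in> eps_grid \<alpha> n e"
  shows "tau_upper \<alpha> n m q x \<le> empirical n X {..real m * t_upper \<alpha> n m q x}"
proof -
  note B = threshold_bounds[OF m q(1,2) level_bounds(2)[OF x]]
  define t where "t = real m * t_upper \<alpha> n m q x"
  define h where "h = lower_tail m (q + r_upper \<alpha> n m q x) t"
  define g where "g = lower_tail m q t"
  have m0: "1 / real m > 0" using m by simp
  have "5 / 4 \<le> exp (1 / 4 :: real)" using exp_ge_add_one_self[of "1 / 4 :: real"] by simp
  then have "exp (- 1 / 4 :: real) \<le> 4 / 5" by (simp add: exp_minus field_simps)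
  then have "exp (- 1 / 4) * g \<le> 4 / 5 * g" by (intro mult_right_mono) (auto simp: g_def lower_tail_nonneg)
  then have hg: "h \<le> 4 / 5 * g" using B(7) by (simp add: h_def g_def t_def)
  have g0: "0 \<le> g" by (simp add: g_def lower_tail_nonneg)
  have "0 \<le> x" using eps_grid_bounds[of n \<alpha> e x] x n L e_bounds by auto
  then have noise: "2 * sqrt (level \<alpha> n 0) \<le> 1 / 100 * h"
    using noise_le_lower_tail[OF x] B(8) by (simp add: h_def t_def)
  have "q \<le> 1" using B(2) m0 by linarith
  then have "g \<le> lower_tail m p t"
    unfolding g_def using p q by (intro lower_tail_antimono) auto
  then have "(1 - \<epsilon>) * g \<le> (1 - \<epsilon>) * lower_tail m p t"
    using \<epsilon> e_bounds by (intro mult_left_mono) auto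
  moreover have "9 / 10 * g \<le> (1 - \<epsilon>) * g"
    using \<epsilon> e_bounds g0 by (intro mult_right_mono) auto
  ultimately have "9 / 10 * g - 2 * sqrt (level \<alpha> n 0) \<le> empirical n X {..t}"
    using lower[OF q(1) x] by (simp add: t_def)
  moreover have "tau_upper \<alpha> n m q x = 11 / 10 * h" using B(9) by (simp add: h_def t_def)
  ultimately show ?thesis using hg noise g0 by (simp add: t_def)
qed

text \<open>
  A grid point \<open>q\<close> with \<open>q + r \<le> p\<close> is rejected at every level that is at least the true \<open>\<epsilon>\<close>.
\<close>

lemma test_rejects:
  assumes q: "q \<in> p_grid m" "q \<noteq> 1" and x: "x \<in> eps_grid \<alpha> n e" "\<epsilon> \<le> x"
    and far: "q + r_upper \<alpha> n m q x \<le> p"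
  shows "empirical n X {..real m * t_upper \<alpha> n m q x} < tau_upper \<alpha> n m q x"
proof -
  note B = threshold_bounds[OF m q(1,2) level_bounds(2)[OF x(1)]]
  define t where "t = real m * t_upper \<alpha> n m q x"
  define h where "h = lower_tail m (q + r_upper \<alpha> n m q x) t"
  have h0: "0 < exp (- 3) / 289 * exp (- ln (1 / level \<alpha> n x) / 8)" by simp
  have h1: "exp (- 3) / 289 * exp (- ln (1 / level \<alpha> n x) / 8) \<le> h"
    using B(8) by (simp add: h_def t_def)
  have "lower_tail m p t \<le> h"
    unfolding h_def using B(1,4) far p by (intro lower_tail_antimono) auto
  then have "empirical n X {..t} \<le> h + (x + 2 * sqrt (level \<alpha> n 0))"
    using upper[OF q(1) x(1)] x(2) by (simp add: t_def)
  also have "\<dots> \<le> h + 1 / 100 * h"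
    using noise_le_lower_tail[OF x(1)] h1 by simp
  also have "\<dots> < 11 / 10 * h" using h0 h1 by linarith
  finally show ?thesis using B(9) by (simp add: h_def t_def)
qed

text \<open>
  For \<open>p > 1 - 1 / m\<close> every value set by the loop is below \<open>p\<close>, so that only the initial value matters.
\<close>

lemma left_covers: "ci_left \<alpha> n m e X \<le> p"
proof (cases "p \<le> 1 - 1 / real m")
  case True
  \<comment> \<open>The grid point \<open>j / m\<close> is the least one above \<open>p\<close>; it is below \<open>1\<close> and is accepted.\<close>
  define j where "j = nat \<lceil>real m * p\<rceil>"
  have m0: "0 < real m" using m by simp
  have "0 \<le> real m * p" using p by simp
  then have j: "real m * p \<le> real j" "real j < real m * p + 1"
    unfolding j_def by linarith+
  have "real m * p \<le> real m - 1" using True m0 by (simp add: field_simps)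
  then have "\<lceil>real m * p\<rceil> \<le> int m - 1" by (intro ceiling_le) simp
  then have jm: "j \<le> m - 1" using m unfolding j_def by linarith
  \<comment> \<open>Then \<open>1 - i / m\<close> is \<open>(j - 1) / m\<close>, truncated at \<open>0\<close>.\<close>
  define i where "i = min m (m - j + 1)"
  have i: "i \<in> {1..m}" using m by (auto simp: i_def)
  have q: "real j / real m \<in> p_grid m" "real j / real m \<noteq> 1" "p \<le> real j / real m"
    using jm j m m0 by (auto simp: p_grid_def field_simps)
  have i1: "real j / real m \<le> 1 - real i / real m + 1 / real m"
    using jm m by (auto simp: i_def min_def of_nat_diff field_simps)
  have i2: "1 - real i / real m \<le> p"
  proof (cases "j = 0")
    case True
    then show ?thesis using m p by (simp add: i_def)
  next
    case False
    then have "i = m - j + 1" using jm m by (simp add: i_def)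
    then have "real i = real m - real j + 1" using jm by (simp add: of_nat_diff)
    then have "1 - real i / real m = (real j - 1) / real m" using m0 by (simp add: field_simps)
    also have "\<dots> \<le> p" using j m0 by (simp add: field_simps)
    finally show ?thesis .
  qed
  have ok: "left_ok \<alpha> n m e X (1 - real i / real m)"
    unfolding left_ok_def using q i1 test_accepts by (intro ballI bexI[of _ "real j / real m"]) auto
  from ci_left_cases[OF m, of \<alpha> n e X] show ?thesis
  proof (elim disjE conjE bexE)
    assume "\<forall>i\<in>{1..m}. \<not> left_ok \<alpha> n m e X (1 - real i / real m)"
    then show ?thesis using ok i by blast
  next
    fix i' assume i': "i' \<in> {1..m}" "ci_left \<alpha> n m e X = 1 - real i' / real m"
      "\<forall>i''\<in>{i'<..m}. \<not> left_ok \<alpha> n m e X (1 - real i'' / real m)"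
    then have "i \<le> i'" using ok i by (metis atLeastAtMost_iff greaterThanAtMost_iff not_le)
    then have "ci_left \<alpha> n m e X \<le> 1 - real i / real m"
      using i' by (simp add: divide_right_mono)
    then show ?thesis using i2 by simp
  qed
next
  case False
  define y where "y = 2 * empirical n X {..real m - 1} + 6 * L / real n"
  have pm: "0 \<le> p ^ m" "p ^ m \<le> 1" using p by (auto simp: power_le_one)
  have "5 / 6 * (1 - p ^ m) \<le> (1 - \<epsilon>) * (1 - p ^ m)"
    using pm \<epsilon> e_bounds by (intro mult_right_mono) auto
  moreover have "0 \<le> L / real n" using L by simp
  ultimately have "1 - p ^ m \<le> y" using edge_lower by (simp add: y_def)
  then have "1 - min y 1 \<le> p ^ m" using pm by (simp add: min_def)
  then have "root m (1 - min y 1) \<le> root m (p ^ m)" using m by simp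
  also have "\<dots> = p" using m p by (simp add: real_root_power_cancel)
  finally have "left_init \<alpha> n m X \<le> p" using False by (simp add: left_init_empirical y_def)
  then show ?thesis using ci_left_le_left_init[OF m, of \<alpha> n e X] by simp
qed

lemma ci_left_nonneg: "0 \<le> ci_left \<alpha> n m e X"
proof -
  have "0 \<le> left_init \<alpha> n m X" using m by (auto simp: left_init_def le_max_iff_disj field_simps)
  moreover have "0 \<le> 1 - real i / real m" if "i \<in> {1..m}" for i
    using that by (simp add: field_simps)
  ultimately show ?thesis using ci_left_cases[OF m, of \<alpha> n e X] by force
qed

text \<open>
  Unless it is the initial value, which is at least \<open>1 - 1 / m\<close>, the endpoint is at least \<open>q - 1 / m\<close> for a
  grid point \<open>q\<close> that is not rejected at the level \<open>x\<close>, and then \<open>p < q + r\<close>.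
\<close>

lemma left_length_middle:
  assumes x: "x \<in> eps_grid \<alpha> n e" "\<epsilon> \<le> x"
  shows "p - ci_left \<alpha> n m e X \<le> 3 / (2 * real m) + 2 * sqrt (2 * (p * (1 - p)) / (real m * ln (1 / level \<alpha> n x)))"
    (is "_ \<le> ?R")
proof -
  have m0: "0 < real m" using m by simp
  have D: "64 \<le> ln (1 / level \<alpha> n x)" using level_bounds[OF x(1)] by simp
  have R: "1 / real m \<le> ?R"
  proof -
    have "0 \<le> sqrt (2 * (p * (1 - p)) / (real m * ln (1 / level \<alpha> n x)))"
      using p m0 D by simp
    moreover have "1 / real m \<le> 3 / (2 * real m)" using m0 by (simp add: field_simps)
    ultimately show ?thesis by linarith
  qed
  from ci_left_cases[OF m, of \<alpha> n e X] show ?thesis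
  proof (elim disjE conjE bexE)
    assume "ci_left \<alpha> n m e X = left_init \<alpha> n m X"
    then have "1 - 1 / real m \<le> ci_left \<alpha> n m e X" by (simp add: left_init_def)
    then show ?thesis using p R by linarith
  next
    fix i assume i: "ci_left \<alpha> n m e X = 1 - real i / real m" "left_ok \<alpha> n m e X (1 - real i / real m)"
    from i(2) x(1) obtain q where "q \<in> {0..1 - real i / real m + 1 / real m} \<inter> (p_grid m - {1})"
      and tau: "tau_upper \<alpha> n m q x \<le> empirical n X {..real m * t_upper \<alpha> n m q x}"
      unfolding left_ok_def by blast
    then have q: "q \<in> p_grid m" "q \<noteq> 1" "q \<le> ci_left \<alpha> n m e X + 1 / real m"
      by (auto simp: i(1))
    note B = threshold_bounds[OF m q(1,2) D]
    have near: "p < q + r_upper \<alpha> n m q x" using test_rejects[OF q(1,2) x] tau by fastforce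
    show ?thesis
    proof (cases "p \<le> q")
      case True
      then show ?thesis using q(3) R by linarith
    next
      case False
      have "1 - q \<le> 2 * (1 - p)" using near B(5) by (simp add: field_simps)
      then have "q * (1 - q) \<le> p * (2 * (1 - p))"
        using False B(1) p by (intro mult_mono) auto
      also have "p * (2 * (1 - p)) = 2 * (p * (1 - p))" by (simp only: mult_ac)
      finally have "sqrt (q * (1 - q) / (real m * ln (1 / level \<alpha> n x))) \<le>
          sqrt (2 * (p * (1 - p)) / (real m * ln (1 / level \<alpha> n x)))"
        using m0 D by (intro real_sqrt_le_mono divide_right_mono) auto
      then have "p - q \<le> 1 / (2 * real m) + 2 * sqrt (2 * (p * (1 - p)) / (real m * ln (1 / level \<alpha> n x)))"
        using near B(6) by linarith
      moreover have "3 / (2 * real m) = 1 / (2 * real m) + 1 / real m" by (simp add: field_simps)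
      ultimately show ?thesis using q(3) by linarith
    qed
  qed
qed

text \<open>
  Since \<open>q + r \<le> (1 + q) / 2 \<le> 1 - 1 / (2 m)\<close> for all grid points \<open>q\<close> below \<open>1\<close>, all of them are rejected at
  a suitable level, and the endpoint keeps its initial value.
\<close>

lemma left_length_edge:
  assumes p_edge: "1 - 1 / (2 * real m) < p"
  shows "p - ci_left \<alpha> n m e X \<le> 8 * (1 - p) + 16 * L * (1 / real m * (1 / real n + \<epsilon>))"
proof -
  have m0: "0 < real m" using m by simp
  obtain x where x: "x \<in> eps_grid \<alpha> n e" "\<epsilon> \<le> x"
    using \<epsilon> eps_grid_nonempty by blast
  have "\<not> left_ok \<alpha> n m e X p'" for p'
  proof
    assume "left_ok \<alpha> n m e X p'"
    then obtain q where q: "q \<in> p_grid m" "q \<noteq> 1"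
      "tau_upper \<alpha> n m q x \<le> empirical n X {..real m * t_upper \<alpha> n m q x}"
      using x unfolding left_ok_def by auto
    note B = threshold_bounds[OF m q(1,2) level_bounds(2)[OF x(1)]]
    have "q + r_upper \<alpha> n m q x \<le> (1 + q) / 2" using B(5) by (simp add: field_simps)
    also have "\<dots> \<le> 1 - 1 / (2 * real m)" using B(2) by (simp add: field_simps)
    finally show False using test_rejects[OF q(1,2) x] q(3) p_edge by linarith
  qed
  then have left: "ci_left \<alpha> n m e X = left_init \<alpha> n m X"
    using ci_left_cases[OF m, of \<alpha> n e X] by blast
  define y where "y = 2 * empirical n X {..real m - 1} + 6 * L / real n"
  have y0: "0 \<le> y" unfolding y_def using L empirical_nonneg[of n X] by (intro add_nonneg_nonneg) auto
  have "1 - 2 * y / real m \<le> left_init \<alpha> n m X"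
  proof (cases "y \<le> 1 / 2")
    case True
    have "1 - 2 * y / real m \<le> root m (1 - y)"
    proof -
      have m1: "2 * y / real m \<le> 1" using True m by (simp add: field_simps)
      have "(1 - 2 * y / real m) ^ m \<le> exp (- (2 * y / real m)) ^ m"
        using m1 exp_ge_add_one_self[of "- (2 * y / real m)"] by (intro power_mono) auto
      also have "\<dots> = exp (- (2 * y))" using m0 by (simp flip: exp_of_nat_mult)
      also have "\<dots> = 1 / exp (2 * y)" by (simp add: exp_minus inverse_eq_divide)
      also have "\<dots> \<le> 1 / (1 + 2 * y)"
        using exp_ge_add_one_self[of "2 * y"] y0 by (intro divide_left_mono) auto
      also have "\<dots> \<le> 1 - y"
      proof -
        have "1 \<le> (1 - y) * (1 + 2 * y)" using True y0 mult_left_mono[of y "1/2" y] by (simp add: algebra_simps)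
        then show ?thesis using y0 by (simp add: field_simps)
      qed
      finally have "root m ((1 - 2 * y / real m) ^ m) \<le> root m (1 - y)" using m by simp
      moreover have "root m ((1 - 2 * y / real m) ^ m) = 1 - 2 * y / real m"
        using m m1 by (intro real_root_power_cancel) auto
      ultimately show ?thesis by simp
    qed
    then show ?thesis using True unfolding left_init_empirical y_def[symmetric] by (simp add: min_def)
  next
    case False
    then have "1 - 2 * y / real m \<le> 1 - 1 / real m" using m0 by (simp add: field_simps)
    then show ?thesis by (simp add: left_init_def)
  qed
  then have "p - ci_left \<alpha> n m e X \<le> 2 * y / real m" using left p by simp
  also have "\<dots> \<le> 2 * (4 * (real m * (1 - p)) + 8 * L * (1 / real n + \<epsilon>)) / real m"
  proof (intro divide_right_mono mult_left_mono)
    have "1 + real m * (p - 1) \<le> (1 + (p - 1)) ^ m" using p by (intro Bernoulli_inequality) auto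
    then have "1 - p ^ m \<le> real m * (1 - p)" by (simp add: algebra_simps)
    moreover have "y \<le> 4 * (1 - p ^ m) + 4 * \<epsilon> + 8 * L / real n"
      using edge_upper by (simp add: y_def)
    moreover have "4 * \<epsilon> \<le> 8 * L * \<epsilon>" using L \<epsilon> by (intro mult_right_mono) auto
    ultimately show "y \<le> 4 * (real m * (1 - p)) + 8 * L * (1 / real n + \<epsilon>)"
      by (simp add: algebra_simps)
  qed auto
  also have "\<dots> = 8 * (1 - p) + 16 * L * (1 / real m * (1 / real n + \<epsilon>))"
    using m0 by (simp add: field_simps)
  finally show ?thesis .
qed

text \<open>
  The level is at most \<open>4 \<epsilon>\<close> or at most \<open>4 sqrt (L / n)\<close>. In the first case
  the second summand on the right is large enough, in the second case the first one.
\<close>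

lemma inv_sqrt_ln_level_le:
  assumes x: "x \<in> eps_grid \<alpha> n e" "x \<le> max (2 * \<epsilon>) (L / real n)"
  shows "1 / sqrt (ln (1 / level \<alpha> n x)) \<le>
    (16 * L + 2) * (1 / sqrt (ln (real n)) + inv_sqrt_log_inv \<epsilon>)"
proof -
  define A where "A = level \<alpha> n x"
  define D where "D = ln (1 / A)"
  have D: "64 \<le> D" and A: "0 < A" using level_bounds[OF x(1)] by (auto simp: A_def D_def)
  have A_D: "ln A = - D" using A by (simp add: D_def ln_div)
  have n0: "0 < real n" using n by simp
  have Ln: "L \<le> real n" using L_div_n_le_1 n0 by (simp add: field_simps)
  then have n2: "2 \<le> real n" using L by linarith
  then have lnn: "0 < ln (real n)" by simp
  have isl: "0 \<le> inv_sqrt_log_inv \<epsilon>"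
    using \<epsilon> e_bounds by (auto simp: inv_sqrt_log_inv_def)
  have sn: "0 \<le> 1 / sqrt (ln (real n))" using lnn by simp
  have K: "1 / sqrt D \<le> b / sqrt l" if "0 < l" "l \<le> b * D" "1 \<le> b" for l b
  proof -
    have "sqrt l \<le> sqrt (b\<^sup>2 * D)"
      using that D by (intro real_sqrt_le_mono order_trans[OF that(2)] mult_right_mono) (auto simp: power2_eq_square)
    then show ?thesis using that D by (simp add: real_sqrt_mult field_simps)
  qed
  have "L / real n \<le> sqrt (L / real n)"
  proof (intro real_le_rsqrt)
    have "L / real n * (L / real n) \<le> L / real n * 1"
      using L_div_n_le_1 L by (intro mult_left_mono) auto
    then show "(L / real n)\<^sup>2 \<le> L / real n" by (simp only: power2_eq_square mult_1_right)
  qed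
  have "sqrt (L / (2 * real n)) \<le> sqrt (L / real n)"
    using L n0 by (intro real_sqrt_le_mono) (simp add: field_simps)
  have "A \<le> 2 * \<epsilon> + 2 * sqrt (L / real n)"
  proof -
    have "0 \<le> L / real n" using L by simp
    then have "x \<le> 2 * \<epsilon> + L / real n" using x(2) \<epsilon> by linarith
    moreover have "A = x + sqrt (L / (2 * real n))" by (simp add: A_def level_def)
    ultimately show ?thesis
      using \<open>L / real n \<le> sqrt (L / real n)\<close> \<open>sqrt (L / (2 * real n)) \<le> sqrt (L / real n)\<close>
      by linarith
  qed
  then consider "A \<le> 4 * \<epsilon>" | "A \<le> 4 * sqrt (L / real n)" by linarith
  then have "1 / sqrt D \<le> (16 * L + 2) * (1 / sqrt (ln (real n))) \<or> 1 / sqrt D \<le> (16 * L + 2) * inv_sqrt_log_inv \<epsilon>"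
  proof cases
    case 1
    then have e0: "0 < \<epsilon>" using A by simp
    have a1: "ln A \<le> ln (4 * \<epsilon>)" using 1 A by (subst ln_le_cancel_iff) auto
    have a2: "ln (4 * \<epsilon>) = ln 4 + ln \<epsilon>" using e0 by (intro ln_mult_pos) auto
    have a3: "ln (4 :: real) \<le> 3" using ln_add_one_self_le_self[of 3] by simp
    have a4: "2 * D \<le> (16 * L + 2) * D" using L D by (intro mult_right_mono) auto
    have "ln (1 / \<epsilon>) = - ln \<epsilon>" using e0 by (simp add: ln_div)
    then have "ln (1 / \<epsilon>) \<le> 2 * D" using a1 a2 a3 A_D D by linarith
    then have "ln (1 / \<epsilon>) \<le> (16 * L + 2) * D" using a4 by (rule order_trans)
    then have "1 / sqrt D \<le> (16 * L + 2) / sqrt (ln (1 / \<epsilon>))"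
      using e0 \<epsilon> e_bounds L by (intro K) auto
    then show ?thesis using e0 by (simp add: inv_sqrt_log_inv_def)
  next
    case 2
    then have "A\<^sup>2 \<le> (4 * sqrt (L / real n))\<^sup>2" using A by (intro power_mono) auto
    also have "\<dots> = 16 * L / real n" using L n0 by (simp add: power_mult_distrib)
    finally have "real n \<le> 16 * L / A\<^sup>2" using A n0 by (simp add: field_simps)
    then have "ln (real n) \<le> ln (16 * L / A\<^sup>2)" using A L n0 by (subst ln_le_cancel_iff) auto
    also have "\<dots> = ln (16 * L) + 2 * D" using A L by (simp add: ln_div ln_realpow A_D)
    also have "\<dots> \<le> 16 * L * D + 2 * D"
    proof -
      have "ln (16 * L) \<le> 16 * L * 1" using L ln_le_minus_one[of "16 * L"] by simp
      also have "\<dots> \<le> 16 * L * D" using L D by (intro mult_left_mono) auto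
      finally show ?thesis by simp
    qed
    finally have "1 / sqrt D \<le> (16 * L + 2) / sqrt (ln (real n))"
      using lnn L by (intro K) (auto simp: algebra_simps)
    then show ?thesis by simp
  qed
  moreover have "0 \<le> (16 * L + 2) * (1 / sqrt (ln (real n)))" "0 \<le> (16 * L + 2) * inv_sqrt_log_inv \<epsilon>"
    using sn isl L by auto
  ultimately show ?thesis unfolding D_def A_def distrib_left by linarith
qed

text \<open>
  Three bounds are combined into the minimum in the rate. The bound by \<open>1 - p\<close> follows from
  \<open>left_length_middle\<close> when \<open>1 - p \<ge> 1 / (2 m)\<close>, since then \<open>1 / m\<close> and \<open>sqrt ((1 - p) / m)\<close> are of the order
  \<open>1 - p\<close>; otherwise \<open>left_length_edge\<close> applies.
\<close>

lemma left_length: "p - ci_left \<alpha> n m e X \<le> 64 * L * rate n \<epsilon> m p"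
proof -
  have m0: "0 < real m" using m by simp
  have n0: "0 < real n" using n by simp
  define W where "W = 1 / sqrt (ln (real n)) + inv_sqrt_log_inv \<epsilon>"
  define s where "s = sqrt (p * (1 - p) / real m)"
  have s0: "0 \<le> s" using p m0 by (simp add: s_def)
  have W0: "0 \<le> W" using n \<epsilon> e_bounds by (auto simp: W_def inv_sqrt_log_inv_def)
  define M where "M = min (min (s * W + 1 / real m) p) (1 - p)"
  define E where "E = 1 / real m * (1 / real n + \<epsilon>)"
  have E0: "0 \<le> E" using \<epsilon> by (simp add: E_def)
  have rate: "rate n \<epsilon> m p = M + E" by (simp add: rate_def M_def E_def s_def W_def)
  have M0: "0 \<le> M" using s0 W0 p by (simp add: M_def)
  show ?thesis
  proof (cases "1 - 1 / (2 * real m) < p")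
    case True
    have "1 / (2 * real m) \<le> 1 / real m" "1 / (2 * real m) \<le> 1 / 2"
      using m by (auto simp: field_simps)
    moreover have "0 \<le> s * W" using s0 W0 by simp
    ultimately have "1 - p \<le> s * W + 1 / real m" "1 - p \<le> p" using True by linarith+
    then have "1 - p \<le> M" by (simp add: M_def)
    then have "8 * (1 - p) \<le> 8 * M" by simp
    also have "\<dots> \<le> 64 * L * M" using L M0 by (intro mult_right_mono) auto
    finally have "8 * (1 - p) \<le> 64 * L * M" .
    moreover have "16 * L * E \<le> 64 * L * E" using L E0 by (intro mult_right_mono) auto
    ultimately show ?thesis
      using left_length_edge[OF True] unfolding rate distrib_left E_def by linarith
  next
    case False
    obtain x where x: "x \<in> eps_grid \<alpha> n e" "\<epsilon> \<le> x" "x \<le> max (2 * \<epsilon>) (L / real n)"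
      using eps_grid_near[OF n _ \<epsilon>, of \<alpha>] L by auto
    define D where "D = ln (1 / level \<alpha> n x)"
    have D: "64 \<le> D" using level_bounds[OF x(1)] by (simp add: D_def)
    have len: "p - ci_left \<alpha> n m e X \<le> 3 / (2 * real m) + 2 * sqrt (2 * (p * (1 - p)) / (real m * D))"
      using left_length_middle[OF x(1,2)] by (simp add: D_def)
    have 1: "p - ci_left \<alpha> n m e X \<le> 64 * L * (s * W + 1 / real m)"
    proof -
      have "sqrt (2 * (p * (1 - p)) / (real m * D)) = sqrt 2 * s * (1 / sqrt D)"
        using m0 by (simp add: s_def real_sqrt_mult real_sqrt_divide)
      also have "\<dots> \<le> (3 / 2) * s * ((16 * L + 2) * W)"
        using inv_sqrt_ln_level_le[OF x(1,3)] s0 W0 L D unfolding D_def[symmetric] W_def[symmetric]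
        by (intro mult_mono real_le_lsqrt) (auto simp: power2_eq_square)
      also have "\<dots> \<le> 3 / 2 * s * (20 * L * W)"
        using L s0 W0 by (intro mult_left_mono mult_right_mono) auto
      finally have "2 * sqrt (2 * (p * (1 - p)) / (real m * D)) \<le> 60 * L * (s * W)" by simp
      also have "\<dots> \<le> 64 * L * (s * W)" using L s0 W0 by (intro mult_right_mono) auto
      finally have "2 * sqrt (2 * (p * (1 - p)) / (real m * D)) \<le> 64 * L * (s * W)" .
      moreover have "3 / (2 * real m) \<le> 64 * L * (1 / real m)" using L m0 by (simp add: field_simps)
      ultimately show ?thesis using len unfolding distrib_left by linarith
    qed
    have 2: "p - ci_left \<alpha> n m e X \<le> 64 * L * p"
    proof -
      have "p \<le> 64 * L * p" using p L by (intro mult_right_mono[of 1 "64 * L" p, simplified]) auto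
      then show ?thesis using ci_left_nonneg by linarith
    qed
    have 3: "p - ci_left \<alpha> n m e X \<le> 64 * L * (1 - p)"
    proof -
      have sixteenth: "2 * u * (2 * (1 * u) / 64) = u\<^sup>2 / 16" for u :: real
        by (simp add: power2_eq_square)
      have a: "1 / real m \<le> 2 * (1 - p)" using False m0 by (simp add: field_simps)
      have "2 * (p * (1 - p)) / (real m * D) = (1 / real m) * (2 * (p * (1 - p)) / D)"
        by simp
      also have "\<dots> \<le> (2 * (1 - p)) * (2 * (1 * (1 - p)) / 64)"
        using a p D by (intro mult_mono frac_le mult_left_mono mult_right_mono) auto
      also have "\<dots> = (1 - p)\<^sup>2 / 16"
        using sixteenth[of "1 - p"] by (simp only:)
      also have "\<dots> \<le> (1 - p)\<^sup>2" by simp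
      finally have "sqrt (2 * (p * (1 - p)) / (real m * D)) \<le> sqrt ((1 - p)\<^sup>2)"
        by (intro real_sqrt_le_mono)
      then have S: "sqrt (2 * (p * (1 - p)) / (real m * D)) \<le> 1 - p" using p by simp
      have T: "3 / (2 * real m) \<le> 3 * (1 - p)" using a by simp
      have "p - ci_left \<alpha> n m e X \<le> 3 * (1 - p) + 2 * (1 - p)"
        by (rule order_trans[OF len add_mono[OF T mult_left_mono[OF S]]]) simp
      also have "\<dots> = 5 * (1 - p)" by simp
      also have "\<dots> \<le> 64 * L * (1 - p)" using L p by (intro mult_right_mono) auto
      finally show ?thesis .
    qed
    have "p - ci_left \<alpha> n m e X \<le> 64 * L * M" using 1 2 3 by (simp add: M_def min_def)
    also have "\<dots> \<le> 64 * L * rate n \<epsilon> m p" unfolding rate using L E0 by (intro mult_left_mono) auto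
    finally show ?thesis .
  qed
qed

end

section \<open>Uniform deviations of empirical frequencies\<close>

text \<open>
  The exponential Markov inequality for a binomial proportion, with an exponent \<open>l\<close> of either sign.
\<close>

lemma chernoff_empirical:
  fixes M :: "real measure" and a l :: real
  assumes M: "prob_space M" and A: "A \<in> sets M" and n: "n \<ge> 1"
  defines "P \<equiv> Pi\<^sub>M {1..n} (\<lambda>_. M)"
  shows "measure P {X \<in> space P. a \<le> l * empirical n X A} \<le>
    exp (real n * (measure M A * (exp l - 1) - a))"
proof -
  interpret M: prob_space M by fact
  interpret P: product_prob_space "\<lambda>_. M" "{1..n}" by unfold_locales
  define f where "f x = exp (l * of_bool (x \<in> A))" for x :: real
  have f_alt: "f = (\<lambda>x. 1 + (exp l - 1) * indicator A x)"
    by (auto simp: f_def indicator_def)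
  have ind: "integrable M (\<lambda>x. (exp l - 1) * indicator A x)"
    using A by (intro integrable_mult_right integrable_real_indicator) (auto simp: M.emeasure_eq_measure)
  then have f_int: "integrable M f"
    unfolding f_alt by (intro Bochner_Integration.integrable_add) auto
  have f_val: "(\<integral>x. f x \<partial>M) = 1 + (exp l - 1) * measure M A"
    unfolding f_alt using A ind by (subst Bochner_Integration.integral_add) (auto simp: M.prob_space)
  define u where "u X = (\<Prod>i\<in>{1..n}. f (X i))" for X :: "nat \<Rightarrow> real"
  have u_int: "integrable P u"
    unfolding u_def P_def using f_int by (intro P.product_integrable_prod) auto
  have u_val: "(\<integral>X. u X \<partial>P) = (1 + (exp l - 1) * measure M A) ^ n"
    unfolding u_def P_def using f_int by (subst P.product_integral_prod) (auto simp: f_val)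
  have u_alt: "u X = exp (real n * (l * empirical n X A))" for X
    using n by (simp add: u_def f_def empirical_def sum_distrib_left flip: exp_sum)
  have "{X \<in> space P. a \<le> l * empirical n X A} = {X \<in> space P. exp (real n * a) \<le> u X}"
    using n by (auto simp: u_alt)
  then have "measure P {X \<in> space P. a \<le> l * empirical n X A} = measure P {X \<in> space P. exp (real n * a) \<le> u X}"
    by simp
  also have "\<dots> \<le> (\<integral>X. u X \<partial>P) / exp (real n * a)"
  proof (rule integral_Markov_inequality_measure[where A = "{}"])
    show "AE X in P. 0 \<le> u X" by (simp add: u_alt)
  qed (use u_int in auto)
  also have "\<dots> \<le> exp ((exp l - 1) * measure M A) ^ n / exp (real n * a)"
  proof -
    have "0 \<le> (\<integral>x. f x \<partial>M)" by (intro Bochner_Integration.integral_nonneg) (simp add: f_def)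
    then show ?thesis unfolding u_val
      using f_val exp_ge_add_one_self[of "(exp l - 1) * measure M A"]
      by (intro divide_right_mono power_mono) auto
  qed
  also have "\<dots> = exp (real n * ((exp l - 1) * measure M A) - real n * a)"
    by (simp only: exp_of_nat_mult exp_diff)
  also have "\<dots> = exp (real n * (measure M A * (exp l - 1) - a))"
    by (simp add: algebra_simps)
  finally show ?thesis .
qed

lemma empirical_measurable:
  fixes M :: "real measure"
  assumes A: "A \<in> sets M" and f: "\<And>i. i \<in> {1..n} \<Longrightarrow> (\<lambda>\<omega>. f \<omega> i) \<in> measurable N M"
  shows "(\<lambda>\<omega>. empirical n (f \<omega>) A) \<in> borel_measurable N"
proof -
  have "(\<lambda>\<omega>. of_bool (f \<omega> i \<in> A) :: real) \<in> borel_measurable N" if "i \<in> {1..n}" for i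
  proof -
    have "(\<lambda>x. indicator A x :: real) \<in> borel_measurable M" using A by simp
    then have "(\<lambda>\<omega>. indicator A (f \<omega> i) :: real) \<in> borel_measurable N"
      using f[OF that] by (rule measurable_compose[rotated])
    then show ?thesis by (simp add: indicator_def of_bool_def)
  qed
  then show ?thesis
    unfolding empirical_def by (intro borel_measurable_times borel_measurable_const borel_measurable_sum)
qed

lemma empirical_PiM_measurable:
  fixes M :: "real measure"
  assumes A: "A \<in> sets M"
  shows "(\<lambda>X. empirical n X A) \<in> borel_measurable (Pi\<^sub>M {1..n} (\<lambda>_. M))"
  using A by (intro empirical_measurable) auto

text \<open>
  Hoeffding's inequality with a smaller constant in the exponent; the choice \<open>l = \<delta> / 2\<close> and the bound
  \<open>exp l \<le> 1 + l + l\<^sup>2\<close> suffice for it.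
\<close>

lemma deviation_empirical:
  fixes M :: "real measure" and \<delta> :: real
  assumes M: "prob_space M" and A: "A \<in> sets M" and n: "n \<ge> 1" and \<delta>: "0 < \<delta>" "\<delta> \<le> 1"
  defines "P \<equiv> Pi\<^sub>M {1..n} (\<lambda>_. M)"
  shows "measure P {X \<in> space P. \<delta> \<le> \<bar>empirical n X A - measure M A\<bar>} \<le> 2 * exp (- (real n * \<delta>\<^sup>2 / 4))"
proof -
  define p where "p = measure M A"
  have p: "0 \<le> p" "p \<le> 1" using prob_space.prob_le_1[OF M] by (auto simp: p_def)
  define l where "l = \<delta> / 2"
  have l: "0 < l" "l \<le> 1" using \<delta> by (auto simp: l_def)
  have meas[measurable]: "(\<lambda>X. empirical n X A) \<in> borel_measurable P"
    unfolding P_def using A by (rule empirical_PiM_measurable)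
  have "(1 + l) * (1 - l + l\<^sup>2) = 1 + l ^ 3" by (simp add: power2_eq_square power3_eq_cube algebra_simps)
  then have "1 \<le> (1 + l) * (1 - l + l\<^sup>2)" using l by simp
  then have "1 / (1 + l) \<le> 1 - l + l\<^sup>2" using l by (simp add: divide_le_eq mult.commute)
  moreover have "exp (- l) \<le> 1 / (1 + l)"
    using exp_ge_add_one_self[of l] l by (simp add: exp_minus inverse_eq_divide frac_le)
  ultimately have el: "exp (- l) - 1 \<le> - l + l\<^sup>2" "exp l - 1 \<le> l + l\<^sup>2"
    using exp_bound[of l] l by auto
  have quad: "p * l\<^sup>2 - l * \<delta> \<le> - (\<delta>\<^sup>2 / 4)"
  proof -
    have "p * l\<^sup>2 \<le> 1 * l\<^sup>2" using p by (intro mult_right_mono) auto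
    then show ?thesis by (simp add: l_def power2_eq_square)
  qed
  have up: "measure P {X \<in> space P. l * (p + \<delta>) \<le> l * empirical n X A} \<le> exp (- (real n * \<delta>\<^sup>2 / 4))"
  proof -
    have "measure P {X \<in> space P. l * (p + \<delta>) \<le> l * empirical n X A} \<le>
        exp (real n * (p * (exp l - 1) - l * (p + \<delta>)))"
      unfolding P_def p_def using M A n by (rule chernoff_empirical)
    also have "p * (exp l - 1) - l * (p + \<delta>) \<le> - (\<delta>\<^sup>2 / 4)"
      using mult_left_mono[OF el(2) p(1)] quad by (simp add: algebra_simps)
    then have "real n * (p * (exp l - 1) - l * (p + \<delta>)) \<le> real n * (- (\<delta>\<^sup>2 / 4))"
      by (intro mult_left_mono) auto
    then have "exp (real n * (p * (exp l - 1) - l * (p + \<delta>))) \<le> exp (- (real n * \<delta>\<^sup>2 / 4))" by simp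
    finally show ?thesis .
  qed
  have down: "measure P {X \<in> space P. - l * (p - \<delta>) \<le> - l * empirical n X A} \<le> exp (- (real n * \<delta>\<^sup>2 / 4))"
  proof -
    have "measure P {X \<in> space P. - l * (p - \<delta>) \<le> - l * empirical n X A} \<le>
        exp (real n * (p * (exp (- l) - 1) - - l * (p - \<delta>)))"
      unfolding P_def p_def using M A n by (rule chernoff_empirical)
    also have "p * (exp (- l) - 1) - - l * (p - \<delta>) \<le> - (\<delta>\<^sup>2 / 4)"
      using mult_left_mono[OF el(1) p(1)] quad by (simp add: algebra_simps)
    then have "real n * (p * (exp (- l) - 1) - - l * (p - \<delta>)) \<le> real n * (- (\<delta>\<^sup>2 / 4))"
      by (intro mult_left_mono) auto
    then have "exp (real n * (p * (exp (- l) - 1) - - l * (p - \<delta>))) \<le> exp (- (real n * \<delta>\<^sup>2 / 4))" by simp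
    finally show ?thesis .
  qed
  interpret PP: prob_space P unfolding P_def by (intro prob_space_PiM M)
  have "measure P {X \<in> space P. \<delta> \<le> \<bar>empirical n X A - p\<bar>} \<le>
      measure P ({X \<in> space P. l * (p + \<delta>) \<le> l * empirical n X A} \<union> {X \<in> space P. - l * (p - \<delta>) \<le> - l * empirical n X A})"
    using l by (intro PP.finite_measure_mono) (auto simp: abs_if split: if_splits)
  also have "\<dots> \<le> measure P {X \<in> space P. l * (p + \<delta>) \<le> l * empirical n X A} +
      measure P {X \<in> space P. - l * (p - \<delta>) \<le> - l * empirical n X A}"
    by (intro measure_Un_le) measurable
  finally show ?thesis using up down by (simp add: p_def)
qed

text \<open>
  A uniform bound over a finite chain of sets, such as half-lines, whose cardinality does not enter. The
  sets are grouped into at most \<open>N + 1\<close> classes on which the probability varies by at most \<open>1 / N\<close>. The union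
  bound is applied only to the least and the greatest set of each class, which bracket the others.
\<close>

lemma uniform_deviation_chain:
  fixes M :: "real measure" and \<delta> :: real and \<T> :: "real set set"
  assumes M: "prob_space M" and fin: "finite \<T>" and sets: "\<T> \<subseteq> sets M"
    and chain: "\<And>A B. A \<in> \<T> \<Longrightarrow> B \<in> \<T> \<Longrightarrow> A \<subseteq> B \<or> B \<subseteq> A"
    and n: "n \<ge> 1" and \<delta>: "0 < \<delta>" "\<delta> \<le> 1" and N: "1 \<le> real N * \<delta>"
  defines "P \<equiv> Pi\<^sub>M {1..n} (\<lambda>_. M)"
  shows "\<exists>B\<in>sets P. measure P B \<le> 4 * (real N + 1) * exp (- (real n * \<delta>\<^sup>2 / 4)) \<and>
    (\<forall>X\<in>space P - B. \<forall>A\<in>\<T>. \<bar>empirical n X A - measure M A\<bar> \<le> 2 * \<delta>)"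
proof -
  interpret M: prob_space M by fact
  interpret PP: prob_space P unfolding P_def by (intro prob_space_PiM M)
  have N0: "0 < real N" using N \<delta> by (cases N) auto
  define cls where "cls A = nat \<lfloor>real N * measure M A\<rfloor>" for A
  define K where "K k = {A \<in> \<T>. cls A = k}" for k
  define bad where "bad C = {X \<in> space P. \<delta> \<le> \<bar>empirical n X C - measure M C\<bar>}" for C
  define J where "J = {k. k \<le> N \<and> K k \<noteq> {}}"
  define B where "B = (\<Union>k\<in>J. bad (\<Inter>(K k)) \<union> bad (\<Union>(K k)))"
  have K_chain: "subset.chain UNIV (K k)" for k
    using chain by (auto simp: K_def subset_chain_def)
  have K_fin: "finite (K k)" for k using fin by (simp add: K_def)
  have mem: "\<Inter>(K k) \<in> K k" "\<Union>(K k) \<in> K k" if "k \<in> J" for k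
    using that Inter_in_chain[OF K_fin _ K_chain] Union_in_chain[OF K_fin _ K_chain] by (auto simp: J_def)
  have K_sets: "C \<in> sets M" if "C \<in> K k" for C k using that sets by (auto simp: K_def)
  have bad_sets[measurable]: "bad C \<in> sets P" if "C \<in> sets M" for C
  proof -
    have [measurable]: "(\<lambda>X. empirical n X C) \<in> borel_measurable P"
      unfolding P_def using that by (rule empirical_PiM_measurable)
    show ?thesis unfolding bad_def by measurable
  qed
  have bad_le: "measure P (bad C) \<le> 2 * exp (- (real n * \<delta>\<^sup>2 / 4))" if "C \<in> sets M" for C
    unfolding bad_def P_def using M that n \<delta> by (rule deviation_empirical)
  have J_fin: "finite J" by (simp add: J_def)
  have B_sets: "B \<in> sets P"
    unfolding B_def using J_fin mem K_sets bad_sets by (intro sets.finite_UN) blast+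
  have "measure P B \<le> (\<Sum>k\<in>J. measure P (bad (\<Inter>(K k)) \<union> bad (\<Union>(K k))))"
    unfolding B_def using J_fin mem K_sets bad_sets by (intro measure_UNION_le) blast+
  also have "\<dots> \<le> (\<Sum>k\<in>J. 4 * exp (- (real n * \<delta>\<^sup>2 / 4)))"
  proof (intro sum_mono)
    fix k assume k: "k \<in> J"
    have C: "\<Inter>(K k) \<in> sets M" "\<Union>(K k) \<in> sets M" using mem[OF k] K_sets by auto
    have "measure P (bad (\<Inter>(K k)) \<union> bad (\<Union>(K k))) \<le> measure P (bad (\<Inter>(K k))) + measure P (bad (\<Union>(K k)))"
      using C bad_sets by (intro measure_Un_le) auto
    then show "measure P (bad (\<Inter>(K k)) \<union> bad (\<Union>(K k))) \<le> 4 * exp (- (real n * \<delta>\<^sup>2 / 4))"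
      using bad_le[OF C(1)] bad_le[OF C(2)] by simp
  qed
  also have "\<dots> = real (card J) * (4 * exp (- (real n * \<delta>\<^sup>2 / 4)))" by simp
  also have "\<dots> \<le> (real N + 1) * (4 * exp (- (real n * \<delta>\<^sup>2 / 4)))"
  proof (intro mult_right_mono)
    have "card J \<le> card {..N}" by (intro card_mono) (auto simp: J_def)
    then show "real (card J) \<le> real N + 1" by simp
  qed simp
  finally have B_le: "measure P B \<le> 4 * (real N + 1) * exp (- (real n * \<delta>\<^sup>2 / 4))" by (simp only: mult_ac)
  have "\<bar>empirical n X A - measure M A\<bar> \<le> 2 * \<delta>" if X: "X \<in> space P - B" and A: "A \<in> \<T>" for X A
  proof -
    define k where "k = cls A"
    have "real N * measure M A \<le> real N * 1" by (intro mult_left_mono) auto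
    then have "\<lfloor>real N * measure M A\<rfloor> \<le> int N" by linarith
    then have kN: "k \<le> N" by (simp add: k_def cls_def)
    have AK: "A \<in> K k" using A by (simp add: K_def k_def)
    then have kJ: "k \<in> J" using kN by (auto simp: J_def)
    have close: "\<bar>measure M C - measure M A\<bar> \<le> \<delta>" if "C \<in> K k" for C
    proof -
      have "nat \<lfloor>real N * measure M C\<rfloor> = nat \<lfloor>real N * measure M A\<rfloor>"
        using that by (simp add: K_def k_def cls_def)
      moreover have "0 \<le> real N * measure M C" "0 \<le> real N * measure M A" by auto
      ultimately have "\<bar>real N * measure M C - real N * measure M A\<bar> \<le> 1" by linarith
      also have "\<dots> \<le> real N * \<delta>" by (rule N)
      finally have "real N * \<bar>measure M C - measure M A\<bar> \<le> real N * \<delta>"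
        by (simp add: abs_mult flip: right_diff_distrib)
      then show ?thesis using N0 by simp
    qed
    have "X \<notin> bad (\<Inter>(K k))" "X \<notin> bad (\<Union>(K k))" using X kJ by (auto simp: B_def)
    then have lo: "\<bar>empirical n X (\<Inter>(K k)) - measure M (\<Inter>(K k))\<bar> < \<delta>"
      and hi: "\<bar>empirical n X (\<Union>(K k)) - measure M (\<Union>(K k))\<bar> < \<delta>"
      using X by (auto simp: bad_def)
    have "empirical n X (\<Inter>(K k)) \<le> empirical n X A" "empirical n X A \<le> empirical n X (\<Union>(K k))"
      using AK by (auto intro!: empirical_mono)
    then show ?thesis
      using lo hi close[OF mem(1)[OF kJ]] close[OF mem(2)[OF kJ]] by linarith
  qed
  then show ?thesis using B_sets B_le by blast
qed

lemma relative_deviation_empirical: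
  fixes M :: "real measure" and l :: real
  assumes M: "prob_space M" and A: "A \<in> sets M" and n: "n \<ge> 1"
  defines "P \<equiv> Pi\<^sub>M {1..n} (\<lambda>_. M)"
  shows "\<exists>B\<in>sets P. measure P B \<le> 2 * exp (- l) \<and>
    (\<forall>X\<in>space P - B. 3 / 5 * measure M A - l / real n \<le> empirical n X A \<and>
       empirical n X A \<le> 2 * measure M A + l / real n)"
proof -
  define p where "p = measure M A"
  have p: "0 \<le> p" by (simp add: p_def)
  have meas[measurable]: "(\<lambda>X. empirical n X A) \<in> borel_measurable P"
    unfolding P_def using A by (rule empirical_PiM_measurable)
  let ?U = "{X \<in> space P. 2 * p + l / real n \<le> 1 * empirical n X A}"
  let ?D = "{X \<in> space P. - (3 / 5 * p - l / real n) \<le> - 1 * empirical n X A}"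
  have n0: "0 < real n" using n by simp
  have U: "measure P ?U \<le> exp (- l)"
  proof -
    have "measure P ?U \<le> exp (real n * (p * (exp 1 - 1) - (2 * p + l / real n)))"
      unfolding P_def p_def using M A n by (rule chernoff_empirical)
    also have "p * (exp 1 - 1) \<le> p * 2" using p exp_le by (intro mult_left_mono) auto
    then have "real n * (p * (exp 1 - 1) - (2 * p + l / real n)) \<le> real n * (- (l / real n))"
      by (intro mult_left_mono) auto
    then have "exp (real n * (p * (exp 1 - 1) - (2 * p + l / real n))) \<le> exp (- l)" using n0 by simp
    finally show ?thesis .
  qed
  have D: "measure P ?D \<le> exp (- l)"
  proof -
    have "5 / 2 \<le> exp (1 :: real)" using exp_lower_Taylor_quadratic[of 1] by simp
    then have e: "exp (- 1 :: real) \<le> 2 / 5" by (simp add: exp_minus field_simps)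
    have "measure P ?D \<le> exp (real n * (p * (exp (- 1) - 1) - - (3 / 5 * p - l / real n)))"
      unfolding P_def p_def using M A n by (rule chernoff_empirical)
    also have "p * (exp (- 1) - 1) \<le> p * (- 3 / 5)" using p e by (intro mult_left_mono) auto
    then have "real n * (p * (exp (- 1) - 1) - - (3 / 5 * p - l / real n)) \<le> real n * (- (l / real n))"
      by (intro mult_left_mono) auto
    then have "exp (real n * (p * (exp (- 1) - 1) - - (3 / 5 * p - l / real n))) \<le> exp (- l)" using n0 by simp
    finally show ?thesis .
  qed
  have "?U \<in> sets P" "?D \<in> sets P" by measurable
  moreover from this have "measure P (?U \<union> ?D) \<le> 2 * exp (- l)"
    using measure_Un_le[of ?U P ?D] U D by simp
  ultimately show ?thesis
    by (intro bexI[of _ "?U \<union> ?D"]) (auto simp: p_def)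
qed

section \<open>Probability of a well-behaved sample\<close>

lemma left_ok_measurable:
  assumes f: "\<And>i. i \<in> {1..n} \<Longrightarrow> (\<lambda>\<omega>. f \<omega> i) \<in> borel_measurable N"
  shows "Measurable.pred N (\<lambda>\<omega>. left_ok \<alpha> n m e (f \<omega>) p)"
proof -
  have [measurable]: "(\<lambda>\<omega>. empirical n (f \<omega>) {..c}) \<in> borel_measurable N" for c
    using f by (intro empirical_measurable[where M = borel]) auto
  show ?thesis
    unfolding left_ok_def by (intro pred_intros_finite) (simp_all, measurable)
qed

text \<open>
  The sample enters through a family of measurable real functions, so that the lemma applies to \<open>X\<close> and to
  \<open>m - X\<close> alike.
\<close>

lemma ci_left_measurable:
  assumes m: "m \<ge> 1" and f: "\<And>i. i \<in> {1..n} \<Longrightarrow> (\<lambda>\<omega>. f \<omega> i) \<in> borel_measurable N"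
  shows "(\<lambda>\<omega>. ci_left \<alpha> n m e (f \<omega>)) \<in> borel_measurable N"
proof -
  let ?st = "\<lambda>j \<omega>. fold (\<lambda>_. left_step \<alpha> n m e (f \<omega>)) [1..<Suc j] (1, left_init \<alpha> n m (f \<omega>))"
  have [measurable]: "(\<lambda>\<omega>. empirical n (f \<omega>) {..c}) \<in> borel_measurable N" for c
    using f by (intro empirical_measurable[where M = borel]) auto
  have [measurable]: "Measurable.pred N (\<lambda>\<omega>. left_ok \<alpha> n m e (f \<omega>) p)" for p
    using f by (rule left_ok_measurable)
  have "(\<lambda>\<omega>. snd (?st j \<omega>)) \<in> borel_measurable N" if "j \<le> m" for j
    using that
  proof (induction j)
    case 0
    show ?case by (simp add: left_init_empirical measurable_compose[OF _ borel_measurable_root])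
  next
    case (Suc j)
    let ?p = "1 - real j / real m - 1 / real m"
    have "snd (?st (Suc j) \<omega>) = (if left_ok \<alpha> n m e (f \<omega>) ?p then ?p else snd (?st j \<omega>))" for \<omega>
    proof -
      define s where "s = ?st j \<omega>"
      have "fst s = 1 - real j / real m"
        using fold_left_step[OF m, of j \<alpha> n e "f \<omega>" "left_init \<alpha> n m (f \<omega>)"] Suc.prems by (simp add: s_def)
      then have s: "s = (1 - real j / real m, snd s)" by (metis prod.collapse)
      have "0 \<le> 1 - real j / real m" using Suc.prems m by simp
      from left_step_eq[OF m this, of \<alpha> n e "f \<omega>" "snd s"]
      have "snd (left_step \<alpha> n m e (f \<omega>) s) = (if left_ok \<alpha> n m e (f \<omega>) ?p then ?p else snd s)"
        unfolding s[symmetric] by simp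
      then show ?thesis by (simp add: s_def)
    qed
    moreover have [measurable]: "(\<lambda>\<omega>. snd (?st j \<omega>)) \<in> borel_measurable N"
      using Suc by simp
    ultimately show ?case by (simp only:) measurable
  qed
  from this[of m] show ?thesis unfolding ci_left_eq by simp
qed

lemma measure_contaminated_binomial:
  assumes \<epsilon>: "0 \<le> \<epsilon>" "\<epsilon> \<le> 1" and Q: "real_distribution Q" and A: "A \<in> sets borel"
  shows "measure (contaminated_binomial m \<epsilon> p Q) A =
    (1 - \<epsilon>) * measure_pmf.prob (binomial_pmf m p) {k. real k \<in> A} + \<epsilon> * measure Q A"
proof -
  interpret Q: real_distribution Q by fact
  have "emeasure (binomial_real m p) A = ennreal (measure_pmf.prob (binomial_pmf m p) {k. real k \<in> A})"
    using A unfolding binomial_real_def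
    by (subst emeasure_distr) (auto simp: vimage_def measure_pmf.emeasure_eq_measure)
  then have "emeasure (contaminated_binomial m \<epsilon> p Q) A =
      ennreal ((1 - \<epsilon>) * measure_pmf.prob (binomial_pmf m p) {k. real k \<in> A} + \<epsilon> * measure Q A)"
    using \<epsilon> A by (subst emeasure_contaminated_binomial)
      (auto simp: Q.emeasure_eq_measure ennreal_mult[symmetric] ennreal_plus[symmetric] simp del: ennreal_plus)
  then show ?thesis using \<epsilon> by (intro measure_eq_emeasure_eq_ennreal) auto
qed

text \<open>
  With \<open>\<delta> = sqrt A\<close>, where \<open>A\<^sup>2 = l / (2 n)\<close>, the exponent \<open>n \<delta>\<^sup>2 / 4\<close> equals \<open>l / (8 A)\<close>. For small \<open>A\<close> this
  outweighs both \<open>l\<close> and the logarithm of the number of classes, a number of the order \<open>1 / sqrt A\<close>.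
\<close>

lemma union_bound_le:
  assumes z: "0 < A" "A \<le> exp (- 64)" and l: "2 \<le> l" "A\<^sup>2 = l / (2 * real n)" and n: "n \<ge> 1"
  shows "4 * (real (nat \<lceil>1 / sqrt A\<rceil>) + 1) * exp (- (real n * (sqrt A)\<^sup>2 / 4)) \<le> exp (- l)"
proof -
  define z where "z = 1 / A"
  have z0: "0 < z" using z by (simp add: z_def)
  have "65 \<le> exp (64 :: real)" using exp_ge_add_one_self[of "64 :: real"] by simp
  also have "\<dots> \<le> z"
    using z by (simp add: z_def exp_minus field_simps)
  finally have z65: "65 \<le> z" .
  have "1 / sqrt A = sqrt z" by (simp add: z_def real_sqrt_divide)
  moreover have "sqrt z \<le> z / 8"
    using z65 by (intro real_le_lsqrt) (auto simp: power2_eq_square field_simps)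
  ultimately have N: "real (nat \<lceil>1 / sqrt A\<rceil>) + 1 \<le> z / 8 + 2"
    using z0 by linarith
  have exponent: "real n * (sqrt A)\<^sup>2 / 4 = l * z / 8"
  proof -
    have "2 * real n * A\<^sup>2 = l" using l n by simp
    then have "l * z = 2 * real n * A" using z by (auto simp: z_def power2_eq_square field_simps)
    then show ?thesis using z by simp
  qed
  define y where "y = z / 4 - 2"
  have y: "14 \<le> y" using z65 by (simp add: y_def)
  have "4 * (z / 8 + 2) = 2 * y + 12" by (simp add: y_def)
  also have "\<dots> \<le> 1 + y + y\<^sup>2 / 2"
  proof -
    have "14 * y \<le> y * y" using y by (intro mult_right_mono) auto
    then show ?thesis unfolding power2_eq_square using y by linarith
  qed
  also have "\<dots> \<le> exp y" using y by (intro exp_lower_Taylor_quadratic) simp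
  also have "\<dots> \<le> exp (l * z / 8 - l)"
  proof -
    have "2 * (z / 8 - 1) \<le> l * (z / 8 - 1)" using l z65 by (intro mult_right_mono) auto
    then show ?thesis by (simp add: y_def algebra_simps)
  qed
  finally have "4 * (z / 8 + 2) \<le> exp (l * z / 8 - l)" .
  then have "4 * (real (nat \<lceil>1 / sqrt A\<rceil>) + 1) * exp (- (l * z / 8)) \<le> exp (l * z / 8 - l) * exp (- (l * z / 8))"
    using N by (intro mult_right_mono) auto
  also have "\<dots> = exp (- l)" by (simp flip: exp_add)
  finally show ?thesis by (simp add: exponent)
qed

text \<open>
  Both the sample and its reflection are well-behaved outside an event of probability at most \<open>\<alpha>\<close>. Two
  chains of half-lines and two events at the edges contribute at most \<open>\<alpha> / 24 + \<alpha> / 24 + \<alpha> / 12 + \<alpha> / 12\<close>.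
\<close>

lemma good_sample_event:
  assumes \<alpha>: "0 < \<alpha>" "\<alpha> < 1" and m: "m \<ge> 1" and n: "n \<ge> 1"
    and \<epsilon>: "0 \<le> \<epsilon>" "\<epsilon> \<le> e" "e \<le> 1" and p: "0 \<le> p" "p \<le> 1"
    and Q: "real_distribution Q"
    and small: "level \<alpha> n e \<le> exp (- 64)"
  defines "P \<equiv> Pi\<^sub>M {1..n} (\<lambda>_. contaminated_binomial m \<epsilon> p Q)"
  shows "\<exists>B\<in>sets P. measure P B \<le> \<alpha> \<and> (\<forall>X\<in>space P - B.
     good_sample \<alpha> e \<epsilon> p n m X \<and> good_sample \<alpha> e \<epsilon> (1 - p) n m (\<lambda>i. real m - X i))"
proof -
  define M where "M = contaminated_binomial m \<epsilon> p Q"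
  define l where "l = ln (24 / \<alpha>)"
  have \<epsilon>1: "\<epsilon> \<le> 1" using \<epsilon> by simp
  interpret Q: real_distribution Q by fact
  interpret M: real_distribution M
    unfolding M_def using \<epsilon> \<epsilon>1 Q by (intro real_distribution_contaminated_binomial)
  have Mp: "prob_space M" by unfold_locales
  interpret PP: prob_space P unfolding P_def M_def[symmetric] by (intro prob_space_PiM Mp)
  have sM: "sets M = sets borel" by simp
  have l: "2 \<le> l" unfolding l_def using \<alpha> by (rule ln_24_div_ge_2)
  have el: "exp (- l) = \<alpha> / 24" using \<alpha> by (simp add: l_def exp_minus)
  define A where "A = level \<alpha> n 0"
  have A: "0 < A" "A \<le> exp (- 64)" "A\<^sup>2 = l / (2 * real n)"
    using l n small \<epsilon> by (auto simp: A_def level_def l_def)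
  define \<delta> where "\<delta> = sqrt A"
  have "exp (- 64 :: real) \<le> 1" by simp
  then have \<delta>: "0 < \<delta>" "\<delta> \<le> 1" using A by (auto simp: \<delta>_def simp del: exp_le_one_iff)
  define N where "N = nat \<lceil>1 / \<delta>\<rceil>"
  have "1 / \<delta> \<le> real N" unfolding N_def by linarith
  then have N: "1 \<le> real N * \<delta>" using \<delta> by (simp add: field_simps)
  have N_le: "4 * (real N + 1) * exp (- (real n * \<delta>\<^sup>2 / 4)) \<le> \<alpha> / 24"
    using union_bound_le[OF A(1,2) l A(3) n] el by (simp add: \<delta>_def N_def)
  define T where "T = (\<lambda>(q, x). real m * t_upper \<alpha> n m q x) ` (p_grid m \<times> eps_grid \<alpha> n e)"
  have T: "finite T" by (simp add: T_def)
  obtain B1 where B1: "B1 \<in> sets P" "measure P B1 \<le> \<alpha> / 24"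
    "\<And>X c. X \<in> space P - B1 \<Longrightarrow> c \<in> T \<Longrightarrow> \<bar>empirical n X {..c} - measure M {..c}\<bar> \<le> 2 * \<delta>"
    using uniform_deviation_chain[OF Mp, of "(\<lambda>c. {..c}) ` T" n \<delta> N] T n \<delta> N N_le
    unfolding P_def M_def[symmetric] by (force simp: sM linear)
  obtain B2 where B2: "B2 \<in> sets P" "measure P B2 \<le> \<alpha> / 24"
    "\<And>X c. X \<in> space P - B2 \<Longrightarrow> c \<in> T \<Longrightarrow> \<bar>empirical n X {real m - c..} - measure M {real m - c..}\<bar> \<le> 2 * \<delta>"
    using uniform_deviation_chain[OF Mp, of "(\<lambda>c. {real m - c..}) ` T" n \<delta> N] T n \<delta> N N_le
    unfolding P_def M_def[symmetric] by (force simp: sM linear)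
  obtain B3 where B3: "B3 \<in> sets P" "measure P B3 \<le> \<alpha> / 12"
    "\<And>X. X \<in> space P - B3 \<Longrightarrow> 3 / 5 * measure M {..real m - 1} - l / real n \<le> empirical n X {..real m - 1} \<and>
       empirical n X {..real m - 1} \<le> 2 * measure M {..real m - 1} + l / real n"
    using relative_deviation_empirical[OF Mp _ n, of "{..real m - 1}" l]
    unfolding P_def M_def[symmetric] by (auto simp: sM el)
  obtain B4 where B4: "B4 \<in> sets P" "measure P B4 \<le> \<alpha> / 12"
    "\<And>X. X \<in> space P - B4 \<Longrightarrow> 3 / 5 * measure M {1..} - l / real n \<le> empirical n X {1..} \<and>
       empirical n X {1..} \<le> 2 * measure M {1..} + l / real n"
    using relative_deviation_empirical[OF Mp _ n, of "{1..}" l]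
    unfolding P_def M_def[symmetric] by (auto simp: sM el)
  define B where "B = B1 \<union> B2 \<union> B3 \<union> B4"
  have Bs: "B \<in> sets P" using B1 B2 B3 B4 by (auto simp: B_def)
  have "measure P B \<le> measure P B1 + measure P B2 + measure P B3 + measure P B4"
    unfolding B_def using B1(1) B2(1) B3(1) B4(1)
    by (meson add_mono_thms_linordered_semiring(3) measure_Un_le order_trans sets.Un)
  also have "\<dots> \<le> \<alpha>" using B1(2) B2(2) B3(2) B4(2) \<alpha> by linarith
  finally have B_le: "measure P B \<le> \<alpha>" .
  have M_bounds: "(1 - \<epsilon>) * measure_pmf.prob (binomial_pmf m p) {k. real k \<in> S} \<le> measure M S"
    "measure M S \<le> measure_pmf.prob (binomial_pmf m p) {k. real k \<in> S} + \<epsilon>" if "S \<in> sets borel" for S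
  proof -
    have eq: "measure M S = (1 - \<epsilon>) * measure_pmf.prob (binomial_pmf m p) {k. real k \<in> S} + \<epsilon> * measure Q S"
      unfolding M_def using \<epsilon> \<epsilon>1 Q that by (intro measure_contaminated_binomial)
    show "(1 - \<epsilon>) * measure_pmf.prob (binomial_pmf m p) {k. real k \<in> S} \<le> measure M S"
      using eq \<epsilon> by simp
    have "(1 - \<epsilon>) * measure_pmf.prob (binomial_pmf m p) {k. real k \<in> S} \<le> 1 * measure_pmf.prob (binomial_pmf m p) {k. real k \<in> S}"
      using \<epsilon> by (intro mult_right_mono) auto
    moreover have "\<epsilon> * measure Q S \<le> \<epsilon> * 1" using \<epsilon> by (intro mult_left_mono) auto
    ultimately show "measure M S \<le> measure_pmf.prob (binomial_pmf m p) {k. real k \<in> S} + \<epsilon>"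
      using eq by simp
  qed
  have low: "(1 - \<epsilon>) * lower_tail m p c \<le> measure M {..c}" "measure M {..c} \<le> lower_tail m p c + \<epsilon>" for c
    using M_bounds[of "{..c}"] by (auto simp: lower_tail_def)
  have high: "(1 - \<epsilon>) * lower_tail m (1 - p) c \<le> measure M {real m - c..}"
    "measure M {real m - c..} \<le> lower_tail m (1 - p) c + \<epsilon>" for c
    using M_bounds[of "{real m - c..}"] by (auto simp: lower_tail_reflect[OF p])
  have edge: "lower_tail m p (real m - 1) = 1 - p ^ m" "lower_tail m (1 - p) (real m - 1) = 1 - (1 - p) ^ m"
    using p m by (auto intro!: lower_tail_below)
  have refl: "empirical n (\<lambda>i. real m - X i) {..c} = empirical n X {real m - c..}" for X c
  proof -
    have "(real m - X i \<le> c) = (real m - c \<le> X i)" for i by auto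
    then show ?thesis by (simp add: empirical_def)
  qed
  have "good_sample \<alpha> e \<epsilon> p n m X \<and> good_sample \<alpha> e \<epsilon> (1 - p) n m (\<lambda>i. real m - X i)"
    if X: "X \<in> space P - B" for X
  proof -
    have memT: "real m * t_upper \<alpha> n m q x \<in> T" if "q \<in> p_grid m" "x \<in> eps_grid \<alpha> n e" for q x
      using that by (auto simp: T_def)
    have X1: "X \<in> space P - B1" "X \<in> space P - B2" "X \<in> space P - B3" "X \<in> space P - B4"
      using X by (auto simp: B_def)
    have c1: "(1 - \<epsilon>) * lower_tail m p c - 2 * sqrt (level \<alpha> n 0) \<le> empirical n X {..c} \<and>
        empirical n X {..c} \<le> lower_tail m p c + \<epsilon> + 2 * sqrt (level \<alpha> n 0)" if "c \<in> T" for c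
      using B1(3)[OF X1(1) that] low[of c] by (simp add: abs_le_iff \<delta>_def A_def)
    have c2: "(1 - \<epsilon>) * lower_tail m (1 - p) c - 2 * sqrt (level \<alpha> n 0) \<le> empirical n X {real m - c..} \<and>
        empirical n X {real m - c..} \<le> lower_tail m (1 - p) c + \<epsilon> + 2 * sqrt (level \<alpha> n 0)" if "c \<in> T" for c
      using B2(3)[OF X1(2) that] high[of c] by (simp add: abs_le_iff \<delta>_def A_def)
    have e1: "3 / 5 * ((1 - \<epsilon>) * (1 - p ^ m)) - ln (24 / \<alpha>) / real n \<le> empirical n X {..real m - 1} \<and>
        empirical n X {..real m - 1} \<le> 2 * (1 - p ^ m + \<epsilon>) + ln (24 / \<alpha>) / real n"
      using B3(3)[OF X1(3)] low[of "real m - 1"] by (simp add: edge l_def)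
    have e2: "3 / 5 * ((1 - \<epsilon>) * (1 - (1 - p) ^ m)) - ln (24 / \<alpha>) / real n \<le> empirical n X {real m - (real m - 1)..} \<and>
        empirical n X {real m - (real m - 1)..} \<le> 2 * (1 - (1 - p) ^ m + \<epsilon>) + ln (24 / \<alpha>) / real n"
      using B4(3)[OF X1(4)] high[of "real m - 1"] by (simp add: edge l_def)
    show ?thesis
      unfolding good_sample_def refl
      using \<alpha> m n \<epsilon> p small c1[OF memT] c2[OF memT] e1 e2 by auto
  qed
  then show ?thesis using Bs B_le by blast
qed

lemma sample_prob_ge:
  assumes B: "B \<in> sets (Pi\<^sub>M {1..n} (\<lambda>_. contaminated_binomial m \<epsilon> p Q))"
      "measure (Pi\<^sub>M {1..n} (\<lambda>_. contaminated_binomial m \<epsilon> p Q)) B \<le> \<alpha>"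
    and \<epsilon>: "0 \<le> \<epsilon>" "\<epsilon> \<le> 1" and Q: "real_distribution Q"
    and E: "Measurable.pred (Pi\<^sub>M {1..n} (\<lambda>_. contaminated_binomial m \<epsilon> p Q)) E"
    and sub: "\<And>X. X \<in> space (Pi\<^sub>M {1..n} (\<lambda>_. contaminated_binomial m \<epsilon> p Q)) - B \<Longrightarrow> E X"
  shows "1 - \<alpha> \<le> sample_prob n m \<epsilon> p Q E"
proof -
  define P where "P = Pi\<^sub>M {1..n} (\<lambda>_. contaminated_binomial m \<epsilon> p Q)"
  interpret M: real_distribution "contaminated_binomial m \<epsilon> p Q"
    using \<epsilon> Q by (intro real_distribution_contaminated_binomial)
  have "prob_space (contaminated_binomial m \<epsilon> p Q)" by unfold_locales
  then interpret PP: prob_space P unfolding P_def by (intro prob_space_PiM)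
  have "1 - \<alpha> \<le> 1 - measure P B" using B(2) by (simp add: P_def)
  also have "\<dots> = measure P (space P - B)" using B(1) by (subst PP.prob_compl) (auto simp: P_def)
  also have "\<dots> \<le> measure P {X \<in> space P. E X}"
    using sub E B(1) by (intro PP.finite_measure_mono) (auto simp: P_def pred_def)
  finally show ?thesis by (simp add: sample_prob_def P_def Let_def)
qed

section \<open>Coverage and length of the confidence interval\<close>

theorem theorem2:
  shows "\<exists>c\<^sub>0 > 0. \<forall>\<alpha>::real. 0 < \<alpha> \<and> \<alpha> < 1 \<longrightarrow> (\<exists>C > 0.
    \<forall>(m::nat) (n::nat) (\<epsilon>\<^sub>m\<^sub>a\<^sub>x::real).
      m \<ge> 1 \<and> n \<ge> 1 \<and> 0 \<le> \<epsilon>\<^sub>m\<^sub>a\<^sub>x \<and> \<epsilon>\<^sub>m\<^sub>a\<^sub>x \<le> 1 \<and> ln (2 / \<alpha>) / real n + \<epsilon>\<^sub>m\<^sub>a\<^sub>x \<le> c\<^sub>0 \<longrightarrow>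
        (INF (\<epsilon>, p, Q) \<in> {0..\<epsilon>\<^sub>m\<^sub>a\<^sub>x} \<times> {0..1} \<times> {Q. real_distribution Q}.
           sample_prob n m \<epsilon> p Q (\<lambda>X. p \<in> CI \<alpha> n m \<epsilon>\<^sub>m\<^sub>a\<^sub>x X)) \<ge> 1 - \<alpha> \<and>
        (INF (\<epsilon>, p, Q) \<in> {0..\<epsilon>\<^sub>m\<^sub>a\<^sub>x} \<times> {0..1} \<times> {Q. real_distribution Q}.
           sample_prob n m \<epsilon> p Q (\<lambda>X. CI_length \<alpha> n m \<epsilon>\<^sub>m\<^sub>a\<^sub>x X \<le> C * rate n \<epsilon> m p)) \<ge> 1 - \<alpha>)"
proof -
  define a :: real where "a = exp (- 64)"
  have a: "0 < a" "a \<le> 1" by (auto simp: a_def)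
  \<comment> \<open>The constant \<open>a\<^sup>2 / 16\<close> is chosen to make all levels at most \<open>a\<close>. It uses \<open>ln (24 / \<alpha>) \<le> 5 ln (2 / \<alpha>)\<close>.\<close>
  have level_small: "level \<alpha> n e \<le> exp (- 64)"
    if \<alpha>: "0 < \<alpha>" "\<alpha> < 1" and n: "n \<ge> 1" and e: "0 \<le> e" and c: "ln (2 / \<alpha>) / real n + e \<le> a\<^sup>2 / 16" for \<alpha> n e
  proof -
    have n0: "0 < real n" using n by simp
    have "ln (24 / \<alpha>) = ln 12 + ln (2 / \<alpha>)"
      using ln_mult_pos[of 12 "2 / \<alpha>"] \<alpha> by simp
    moreover have "ln 12 \<le> 4 * ln (2 :: real)"
    proof -
      have "ln 12 \<le> ln ((2 :: real) ^ 4)" by (subst ln_le_cancel_iff) auto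
      also have "ln ((2 :: real) ^ 4) = 4 * ln 2" by (subst ln_realpow) auto
      finally show ?thesis .
    qed
    moreover have "ln 2 \<le> ln (2 / \<alpha>)" using \<alpha> by (subst ln_le_cancel_iff) (auto simp: field_simps)
    ultimately have L: "ln (24 / \<alpha>) \<le> 5 * ln (2 / \<alpha>)" by linarith
    have "ln (24 / \<alpha>) / (2 * real n) \<le> 5 / 2 * (ln (2 / \<alpha>) / real n)"
      using L n0 by (simp add: field_simps)
    also have "\<dots> \<le> 5 / 2 * (a\<^sup>2 / 16)" using c e by (intro mult_left_mono) auto
    also have "\<dots> \<le> (a / 2)\<^sup>2" by (simp add: power2_eq_square)
    finally have "sqrt (ln (24 / \<alpha>) / (2 * real n)) \<le> a / 2"
      using a by (intro real_le_lsqrt) auto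
    moreover have "e \<le> a / 2"
    proof -
      have "0 \<le> ln (2 / \<alpha>) / real n" using \<alpha> by (intro divide_nonneg_nonneg) auto
      moreover have "a\<^sup>2 \<le> a * 1" unfolding power2_eq_square using a by (intro mult_left_mono) auto
      ultimately show ?thesis using c a by linarith
    qed
    ultimately show ?thesis by (simp add: level_def a_def)
  qed
  show ?thesis
  proof (rule exI[of _ "a\<^sup>2 / 16"], intro conjI allI impI)
    show "0 < a\<^sup>2 / 16" using a by simp
    fix \<alpha> :: real assume \<alpha>: "0 < \<alpha> \<and> \<alpha> < 1"
    define C where "C = 128 * ln (24 / \<alpha>)"
    have C0: "0 < C" using \<alpha> by (simp add: C_def field_simps)
    have main: "1 - \<alpha> \<le> sample_prob n m \<epsilon> p Q (\<lambda>X. p \<in> CI \<alpha> n m e X) \<and>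
        1 - \<alpha> \<le> sample_prob n m \<epsilon> p Q (\<lambda>X. CI_length \<alpha> n m e X \<le> C * rate n \<epsilon> m p)"
      if m: "m \<ge> 1" and n: "n \<ge> 1" and e: "e \<le> 1" and c: "ln (2 / \<alpha>) / real n + e \<le> a\<^sup>2 / 16"
        and \<epsilon>: "0 \<le> \<epsilon>" "\<epsilon> \<le> e" and p: "0 \<le> p" "p \<le> 1" and Q: "real_distribution Q"
      for m n e \<epsilon> p Q
    proof -
      let ?P = "Pi\<^sub>M {1..n} (\<lambda>_. contaminated_binomial m \<epsilon> p Q)"
      have small: "level \<alpha> n e \<le> exp (- 64)" using \<alpha> n c \<epsilon> by (intro level_small) auto
      obtain B where B: "B \<in> sets ?P" "measure ?P B \<le> \<alpha>"
        and good: "\<And>X. X \<in> space ?P - B \<Longrightarrow> good_sample \<alpha> e \<epsilon> p n m X"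
          "\<And>X. X \<in> space ?P - B \<Longrightarrow> good_sample \<alpha> e \<epsilon> (1 - p) n m (\<lambda>i. real m - X i)"
        using good_sample_event[OF _ _ m n \<epsilon> e p Q small] \<alpha> by blast
      have comp[measurable]: "(\<lambda>X. X i) \<in> borel_measurable ?P" if "i \<in> {1..n}" for i
      proof -
        have "(\<lambda>X. X i) \<in> measurable ?P (contaminated_binomial m \<epsilon> p Q)"
          using that by (rule measurable_component_singleton)
        then show ?thesis by (simp cong: measurable_cong_sets)
      qed
      have [measurable]: "(\<lambda>X. ci_left \<alpha> n m e X) \<in> borel_measurable ?P"
        using m comp by (rule ci_left_measurable)
      have [measurable]: "(\<lambda>X. ci_right \<alpha> n m e X) \<in> borel_measurable ?P"
      proof -
        have "(\<lambda>X. ci_left \<alpha> n m e (\<lambda>i. real m - X i)) \<in> borel_measurable ?P"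
          using m by (rule ci_left_measurable) (intro borel_measurable_diff borel_measurable_const comp)
        then show ?thesis unfolding ci_right_reflect[OF m] by simp
      qed
      have cover: "p \<in> CI \<alpha> n m e X" if "X \<in> space ?P - B" for X
        using good_sample.left_covers[OF good(1)[OF that]] good_sample.left_covers[OF good(2)[OF that]]
        by (simp add: CI_def ci_right_reflect[OF m])
      have short: "0 \<le> rate n \<epsilon> m p \<and> CI_length \<alpha> n m e X \<le> C * rate n \<epsilon> m p" if "X \<in> space ?P - B" for X
      proof -
        have "rate n \<epsilon> m (1 - p) = rate n \<epsilon> m p"
          by (simp add: rate_def mult.commute min.commute min.left_commute min.assoc)
        then have r: "(1 - p) - ci_left \<alpha> n m e (\<lambda>i. real m - X i) \<le> 64 * ln (24 / \<alpha>) * rate n \<epsilon> m p"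
          using good_sample.left_length[OF good(2)[OF that]] by simp
        have l: "p - ci_left \<alpha> n m e X \<le> 64 * ln (24 / \<alpha>) * rate n \<epsilon> m p"
          using good_sample.left_length[OF good(1)[OF that]] .
        have "0 \<le> 64 * ln (24 / \<alpha>) * rate n \<epsilon> m p"
          using l good_sample.left_covers[OF good(1)[OF that]] by linarith
        \<comment> \<open>The length is \<open>0\<close> for an empty interval, hence the need for a nonnegative right-hand side.\<close>
        moreover have "0 < ln (24 / \<alpha>)" using C0 by (simp add: C_def)
        ultimately have "0 \<le> rate n \<epsilon> m p" by (simp add: zero_le_mult_iff)
        then show ?thesis using l r C0
          by (simp add: CI_length_def Let_def ci_right_reflect[OF m] C_def)
      qed
      have "1 - \<alpha> \<le> sample_prob n m \<epsilon> p Q (\<lambda>X. p \<in> CI \<alpha> n m e X)"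
      proof (rule sample_prob_ge[OF B])
        show "Measurable.pred ?P (\<lambda>X. p \<in> CI \<alpha> n m e X)"
          unfolding CI_def atLeastAtMost_iff by measurable
      qed (use \<epsilon> e Q cover in auto)
      moreover have "1 - \<alpha> \<le> sample_prob n m \<epsilon> p Q (\<lambda>X. CI_length \<alpha> n m e X \<le> C * rate n \<epsilon> m p)"
      proof (rule sample_prob_ge[OF B])
        show "Measurable.pred ?P (\<lambda>X. CI_length \<alpha> n m e X \<le> C * rate n \<epsilon> m p)"
          unfolding CI_length_def Let_def by measurable
      qed (use \<epsilon> e Q short in auto)
      ultimately show ?thesis by simp
    qed
    show "\<exists>C>0. \<forall>(m::nat) (n::nat) (\<epsilon>\<^sub>m\<^sub>a\<^sub>x::real).
      m \<ge> 1 \<and> n \<ge> 1 \<and> 0 \<le> \<epsilon>\<^sub>m\<^sub>a\<^sub>x \<and> \<epsilon>\<^sub>m\<^sub>a\<^sub>x \<le> 1 \<and> ln (2 / \<alpha>) / real n + \<epsilon>\<^sub>m\<^sub>a\<^sub>x \<le> a\<^sup>2 / 16 \<longrightarrow>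
        (INF (\<epsilon>, p, Q) \<in> {0..\<epsilon>\<^sub>m\<^sub>a\<^sub>x} \<times> {0..1} \<times> {Q. real_distribution Q}.
           sample_prob n m \<epsilon> p Q (\<lambda>X. p \<in> CI \<alpha> n m \<epsilon>\<^sub>m\<^sub>a\<^sub>x X)) \<ge> 1 - \<alpha> \<and>
        (INF (\<epsilon>, p, Q) \<in> {0..\<epsilon>\<^sub>m\<^sub>a\<^sub>x} \<times> {0..1} \<times> {Q. real_distribution Q}.
           sample_prob n m \<epsilon> p Q (\<lambda>X. CI_length \<alpha> n m \<epsilon>\<^sub>m\<^sub>a\<^sub>x X \<le> C * rate n \<epsilon> m p)) \<ge> 1 - \<alpha>"
    proof (rule exI[of _ C], intro conjI allI impI, goal_cases)
      case 1
      show ?case by (rule C0)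
    next
      case (2 m n e)
      have ex: "real_distribution (return borel 0)"
        by (auto simp: real_distribution_def real_distribution_axioms_def intro!: prob_space_return)
      show ?case
        using 2 ex main by (intro cINF_greatest) (force, auto)
    next
      case (3 m n e)
      have ex: "real_distribution (return borel 0)"
        by (auto simp: real_distribution_def real_distribution_axioms_def intro!: prob_space_return)
      show ?case
        using 3 ex main by (intro cINF_greatest) (force, auto)
    qed
  qed
qed

end
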